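(* Let $(q_k,p_{k1},p_{k2})_{k\ge2}$ be real numbers with $q_k>0$, $p_{k1}\ge0$, $p_{k2}>0$ and $q_k+p_{k1}+p_{k2}=1$ for all $k\ge2$, let $X$, $Y$ be the (2,1) and (1,2) random walks defined in the context, and let $Z\in\{X,Y\}$. For $n\ge2$ let $S_n=\#\{k\in[2,n]: k \text{ is a cutpoint of } Z\}$. Suppose that $a_k\to a>0$ and $b_k\to b>0$ as $k\to\infty$. Fix $\beta\ge0$ and let $r_n$ be as in the context. Assume $\varrho_k=1-3r_k+O(r_k^2)$ as $k\to\infty$ if $Z=X$, and $\varrho_k=1+3r_k+O(r_k^2)$ as $k\to\infty$ if $Z=Y$. If $0\le\beta<1$, then there are constants $0<c_3<c_4<\infty$ such that $$c_3\le \liminf_{n\to\infty}\frac{ES_n}{\log n(\log\log n)^{-\beta}}\le\limsup_{n\to\infty}\frac{ES_n}{\log n(\log\log n)^{-\beta}}\le c_4,$$ and for each $\varepsilon>0$, $$\lim_{n\to\infty}\frac{S_n}{(\log n)^{1+\varepsilon}(\log\log n)^{-\beta}}=0\quad\text{almost surely.}$$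
   Context: $\mathbb Z_+=\{0,1,2,\dots\}$. The (2,1) random walk $X$ is the Markov chain on $\mathbb Z_+$ with $X_0=2$, $P(X_{k+1}=1\mid X_k=0)=P(X_{k+1}=2\mid X_k=1)=1$ and, for $n\ge2$, $P(X_{k+1}=n+1\mid X_k=n)=q_n$, $P(X_{k+1}=n-1\mid X_k=n)=p_{n1}$, $P(X_{k+1}=n-2\mid X_k=n)=p_{n2}$. The (1,2) random walk $Y$ is the Markov chain on $\mathbb Z_+$ with $Y_0=2$, $P(Y_{k+1}=0\mid Y_k=1)=P(Y_{k+1}=2\mid Y_k=0)=1$ and, for $n\ge2$, $P(Y_{k+1}=n-1\mid Y_k=n)=q_n$, $P(Y_{k+1}=n+1\mid Y_k=n)=p_{n1}$, $P(Y_{k+1}=n+2\mid Y_k=n)=p_{n2}$. For $k\ge2$, $a_k=(p_{k1}+p_{k2})/q_k$, $b_k=p_{k2}/q_k$, $\varrho_k=\frac{a_k+\sqrt{a_k^2+4b_k}}{2}$. A site $k$ is a cutpoint of $X$ if $X$ visits $k$ exactly once; $k$ is a cutpoint of $Y$ if $Y$ never visits $k$. For fixed $\beta\ge0$: $r_n=\frac13\left(\frac1n+\frac{1}{n(\log\log n)^\beta}\right)$ for $n\ge4$ and $r_2=r_3=r_4$. *)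

theory Defs
  imports "HOL-Probability.Probability" "HOL-Library.Landau_Symbols"
begin

definition trans_kernel :: "bool \<Rightarrow> (nat \<Rightarrow> real) \<Rightarrow> (nat \<Rightarrow> real) \<Rightarrow> (nat \<Rightarrow> real)
    \<Rightarrow> nat \<Rightarrow> nat \<Rightarrow> real" where
  "trans_kernel isX q p1 p2 n m =
     (if isX then
        (if n = 0 then (if m = 1 then 1 else 0)
         else if n = 1 then (if m = 2 then 1 else 0)
         else if m = n + 1 then q n
         else if m = n - 1 then p1 n
         else if m = n - 2 then p2 n else 0)
      else
        (if n = 1 then (if m = 0 then 1 else 0)
         else if n = 0 then (if m = 2 then 1 else 0)
         else if m = n - 1 then q n
         else if m = n + 1 then p1 n
         else if m = n + 2 then p2 n else 0))"

definition is_markov_chain :: "'a measure \<Rightarrow> (nat \<Rightarrow> 'a \<Rightarrow> nat) \<Rightarrow> nat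
    \<Rightarrow> (nat \<Rightarrow> nat \<Rightarrow> real) \<Rightarrow> bool" where
  "is_markov_chain M Z x0 P \<longleftrightarrow>
     prob_space M \<and> (\<forall>n. Z n \<in> M \<rightarrow>\<^sub>M count_space UNIV) \<and>
     (\<forall>n (x :: nat \<Rightarrow> nat).
        measure M {\<omega> \<in> space M. \<forall>i\<le>n. Z i \<omega> = x i} =
        (if x 0 = x0 then 1 else 0) * (\<Prod>i<n. P (x i) (x (i + 1))))"

definition is_cutpoint :: "bool \<Rightarrow> (nat \<Rightarrow> nat) \<Rightarrow> nat \<Rightarrow> bool" where
  "is_cutpoint isX pth k =
     (if isX then card {n. pth n = k} = 1 else (\<forall>n. pth n \<noteq> k))"

definition num_cutpoints :: "bool \<Rightarrow> (nat \<Rightarrow> nat) \<Rightarrow> nat \<Rightarrow> nat" where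
  "num_cutpoints isX pth n = card {k \<in> {2..n}. is_cutpoint isX pth k}"

definition rho_walk :: "(nat \<Rightarrow> real) \<Rightarrow> (nat \<Rightarrow> real) \<Rightarrow> (nat \<Rightarrow> real) \<Rightarrow> nat \<Rightarrow> real" where
  "rho_walk q p1 p2 k =
     (let a = (p1 k + p2 k) / q k; b = p2 k / q k in (a + sqrt (a\<^sup>2 + 4 * b)) / 2)"

definition r_seq :: "real \<Rightarrow> nat \<Rightarrow> real" where
  "r_seq \<beta> n = (let m = max n 4 in
     (1 / real m + 1 / (real m * (ln (ln (real m))) powr \<beta>)) / 3)"

end

theory Submission
  imports Defs "HOL-Real_Asymp.Real_Asymp"
begin

text \<open>
  Write a harmonic function of the walk as \<open>h k = (\<Sum>j\<ge>k. u j)\<close>. Harmonicity turns into a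
  two-term recursion for \<open>u\<close>, forward for \<open>X\<close> and backward for \<open>Y\<close>, whose coefficients are
  \<open>a\<^sub>k, b\<^sub>k\<close>. The ratio of consecutive increments obeys a contracting continued-fraction
  recursion with approximate fixed point \<open>\<rho>\<^sub>k\<close> (or its inverse), so in both cases
  \<open>u k / u (k - 1) = 1 - 3 r\<^sub>k + O(r\<^sub>k\<^sup>2)\<close>. With \<open>V k = k (ln ln k) powr \<beta>\<close> this gives
  \<open>V k * u k - V (k + 1) * u (k + 1) \<sim> u k\<close>, and summing, \<open>u k / h k \<sim> 1 / V k\<close>.

  Since \<open>sqrt h\<close> is strictly superharmonic, the walk is transient. A site \<open>k\<close> is then almost
  surely a cutpoint iff the walk steps to \<open>k + 1\<close> from its first visit to \<open>k\<close> (for \<open>X\<close>) or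
  from \<open>k - 1\<close> before any visit to \<open>k\<close> (for \<open>Y\<close>), and stays above \<open>k\<close> ever after. Optional
  stopping of \<open>h\<close> bounds the probability of the last event by constants times \<open>u k / h k\<close>, so
  \<open>k\<close> is a cutpoint with probability of order \<open>1 / V k\<close>, and \<open>\<Sum>k\<le>n. 1 / V k\<close> is of order
  \<open>ln n (ln ln n) powr (- \<beta>)\<close>. The almost sure statement follows from the bound on the
  expectation along \<open>n = 2 ^ 2 ^ j\<close> and monotonicity of the counts.
\<close>

section \<open>Sequences\<close>

lemma stolz_cesaro_le:
  fixes f G :: "nat \<Rightarrow> real"
  assumes G_at_top: "filterlim G at_top sequentially"
    and step: "eventually (\<lambda>n. f (Suc n) - f n \<le> c * (G (Suc n) - G n)) sequentially"
    and "c < d"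
  shows "eventually (\<lambda>n. f n \<le> d * G n) sequentially"
proof -
  obtain N where step_le: "f (Suc n) - f n \<le> c * (G (Suc n) - G n)" if "n \<ge> N" for n
    using step unfolding eventually_sequentially by blast
  have decreasing: "f n - c * G n \<le> f N - c * G N" if "n \<ge> N" for n
    using that
  proof (induction rule: dec_induct)
    case (step n)
    thus ?case using step_le[of n] by (simp add: algebra_simps)
  qed simp
  have "eventually (\<lambda>n. (f N - c * G N) / (d - c) \<le> G n) sequentially"
    using G_at_top by (simp add: filterlim_at_top)
  thus ?thesis using eventually_ge_at_top[of N]
  proof eventually_elim
    case (elim n)
    have "f N - c * G N \<le> (d - c) * G n"
      using elim(1) \<open>c < d\<close> by (simp add: field_simps)
    thus ?case using decreasing[OF elim(2)] by (simp add: algebra_simps)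
  qed
qed

lemma stolz_cesaro_ge:
  fixes f G :: "nat \<Rightarrow> real"
  assumes "filterlim G at_top sequentially"
    and "eventually (\<lambda>n. c * (G (Suc n) - G n) \<le> f (Suc n) - f n) sequentially"
    and "d < c"
  shows "eventually (\<lambda>n. d * G n \<le> f n) sequentially"
proof -
  have "eventually (\<lambda>n. - f n \<le> - d * G n) sequentially"
  proof (rule stolz_cesaro_le[OF assms(1)])
    show "eventually (\<lambda>n. - f (Suc n) - - f n \<le> - c * (G (Suc n) - G n)) sequentially"
      using assms(2) by eventually_elim simp
  qed (use \<open>d < c\<close> in simp)
  thus ?thesis by eventually_elim simp
qed

definition tail_sum :: "(nat \<Rightarrow> real) \<Rightarrow> nat \<Rightarrow> real" where
  "tail_sum u k = (\<Sum>j. u (j + k))"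

lemma tail_sum_Suc: "summable u \<Longrightarrow> tail_sum u k = u k + tail_sum u (Suc k)"
  using suminf_split_head[of "\<lambda>j. u (j + k)"] by (simp add: tail_sum_def summable_iff_shift)

lemma tail_sum_pos: "summable u \<Longrightarrow> (\<And>n. u n > 0) \<Longrightarrow> tail_sum u k > 0"
  unfolding tail_sum_def by (intro suminf_pos summable_ignore_initial_segment)

lemma tail_sum_tendsto_0:
  assumes "summable u"
  shows "tail_sum u \<longlonglongrightarrow> 0"
proof -
  have "(\<lambda>k. suminf u - sum u {..<k}) \<longlonglongrightarrow> suminf u - suminf u"
    by (intro tendsto_intros summable_LIMSEQ assms)
  thus ?thesis by (simp add: tail_sum_def[abs_def] suminf_minus_initial_segment[OF assms])
qed

lemma stolz_cesaro_tail_sum: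
  fixes u v :: "nat \<Rightarrow> real"
  assumes u_pos: "\<And>n. u n > 0" and "summable u" and "v \<longlonglongrightarrow> 0"
    and quotient: "(\<lambda>n. (v n - v (Suc n)) / u n) \<longlonglongrightarrow> L"
  shows "(\<lambda>k. v k / tail_sum u k) \<longlonglongrightarrow> L"
proof (rule tendstoI)
  fix e :: real assume "e > 0"
  hence "eventually (\<lambda>n. dist ((v n - v (Suc n)) / u n) L < e / 2) sequentially"
    by (intro tendstoD[OF quotient]) simp
  then obtain N where quotient_near_L: "dist ((v n - v (Suc n)) / u n) L < e / 2" if "n \<ge> N" for n
    unfolding eventually_sequentially by blast
  show "eventually (\<lambda>k. dist (v k / tail_sum u k) L < e) sequentially"
    using eventually_ge_at_top[of N]
  proof eventually_elim
    case (elim k)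
    have u_sums: "(\<lambda>j. u (j + k)) sums tail_sum u k"
      using \<open>summable u\<close> by (simp add: tail_sum_def summable_iff_shift summable_sums)
    have v_sums: "(\<lambda>j. v (j + k) - v (Suc j + k)) sums v k"
      using telescope_sums'[of "\<lambda>j. v (j + k)" 0] \<open>v \<longlonglongrightarrow> 0\<close>
      by (simp add: LIMSEQ_ignore_initial_segment)
    have increment: "(L - e / 2) * u (j + k) \<le> v (j + k) - v (Suc j + k)"
      "v (j + k) - v (Suc j + k) \<le> (L + e / 2) * u (j + k)" for j
      using quotient_near_L[of "j + k"] elim u_pos[of "j + k"]
      by (auto simp: dist_real_def abs_if field_simps split: if_splits)
    have "(L - e / 2) * tail_sum u k \<le> v k" "v k \<le> (L + e / 2) * tail_sum u k"
      by (rule sums_le[OF increment(1) sums_mult[OF u_sums] v_sums],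
          rule sums_le[OF increment(2) v_sums sums_mult[OF u_sums]])
    hence "L - e / 2 \<le> v k / tail_sum u k" "v k / tail_sum u k \<le> L + e / 2"
      using tail_sum_pos[OF \<open>summable u\<close> u_pos, of k] by (simp_all add: field_simps)
    thus ?case using \<open>e > 0\<close> unfolding dist_real_def by linarith
  qed
qed

lemma summable_convergent_if_increment_quotient:
  fixes u v :: "nat \<Rightarrow> real"
  assumes u_pos: "\<And>n. u n > 0" and v_nonneg: "eventually (\<lambda>n. v n \<ge> 0) sequentially"
    and quotient: "(\<lambda>n. (v n - v (Suc n)) / u n) \<longlonglongrightarrow> L" and "L > 0"
  shows "summable u" "convergent v"
proof -
  have "eventually (\<lambda>n. (v n - v (Suc n)) / u n > L / 2) sequentially"
    using \<open>L > 0\<close> by (intro order_tendstoD[OF quotient]) simp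
  with v_nonneg have "eventually (\<lambda>n. v n \<ge> 0 \<and> L / 2 * u n \<le> v n - v (Suc n)) sequentially"
  proof eventually_elim
    case (elim n)
    thus ?case using u_pos[of n] by (simp add: field_simps)
  qed
  then obtain N where from_N: "v n \<ge> 0" "L / 2 * u n \<le> v n - v (Suc n)" if "n \<ge> N" for n
    unfolding eventually_sequentially by blast
  have "summable (\<lambda>n. L / 2 * u (n + N))"
  proof (rule summableI_nonneg_bounded)
    fix m
    have "(\<Sum>i<m. L / 2 * u (i + N)) \<le> (\<Sum>i<m. v (i + N) - v (Suc i + N))"
      using from_N by (intro sum_mono) auto
    also have "\<dots> = v N - v (m + N)" by (subst sum_lessThan_telescope') simp
    also have "\<dots> \<le> v N" using from_N(1)[of "m + N"] by simp
    finally show "(\<Sum>i<m. L / 2 * u (i + N)) \<le> v N" .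
  qed (use u_pos \<open>L > 0\<close> in \<open>simp add: less_imp_le\<close>)
  thus "summable u"
    using \<open>L > 0\<close> by (simp add: summable_cmult_iff summable_iff_shift)
  have "decseq (\<lambda>n. v (n + N))"
  proof (rule decseq_SucI)
    fix n
    have "0 \<le> L / 2 * u (n + N)" using u_pos[of "n + N"] \<open>L > 0\<close> by simp
    thus "v (Suc n + N) \<le> v (n + N)" using from_N(2)[of "n + N"] by simp
  qed
  then obtain l where "(\<lambda>n. v (n + N)) \<longlonglongrightarrow> l"
    using decseq_convergent[of "\<lambda>n. v (n + N)" 0] from_N(1) by (metis le_add2)
  thus "convergent v" by (auto intro: convergentI LIMSEQ_offset)
qed

lemma strict_mono_first_exceeding:
  fixes t :: "nat \<Rightarrow> nat"
  assumes t_mono: "strict_mono t"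
  obtains l where "\<And>n. n < t (l n)" "\<And>n j. j < l n \<Longrightarrow> t j \<le> n" "filterlim l at_top sequentially"
proof -
  define l where "l n = (LEAST j. n < t j)" for n
  have exceeds: "n < t (l n)" for n
    unfolding l_def by (rule LeastI[of _ "Suc n"]) (use seq_suble[OF t_mono, of "Suc n"] in simp)
  moreover have "t j \<le> n" if "j < l n" for j n
    using not_less_Least[OF that[unfolded l_def]] by simp
  moreover have "filterlim l at_top sequentially"
    unfolding filterlim_at_top
  proof
    fix K
    show "eventually (\<lambda>n. K \<le> l n) sequentially"
      using eventually_ge_at_top[of "t K"]
    proof eventually_elim
      case (elim n)
      hence "t K < t (l n)" using exceeds[of n] by simp
      thus ?case using strict_mono_less[OF t_mono] by simp
    qed
  qed
  ultimately show ?thesis by (rule that)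
qed

lemma mono_ratio_tendsto_0_of_subseq:
  fixes s W :: "nat \<Rightarrow> real" and t :: "nat \<Rightarrow> nat"
  assumes s_mono_nonneg: "mono s" "\<And>n. s n \<ge> 0" and t_mono: "strict_mono t"
    and W_pos: "\<And>n. n \<ge> t 0 \<Longrightarrow> W n > 0"
    and W_le: "\<And>j n. t j \<le> n \<Longrightarrow> n < t (Suc j) \<Longrightarrow> W (t (Suc j)) \<le> c * W n"
    and subseq_lim: "(\<lambda>j. s (t j) / W (t j)) \<longlonglongrightarrow> 0"
  shows "(\<lambda>n. s n / W n) \<longlonglongrightarrow> 0"
proof -
  obtain l where exceeding: "\<And>n. n < t (l n)" "\<And>n j. j < l n \<Longrightarrow> t j \<le> n"
    "filterlim l at_top sequentially"
    using strict_mono_first_exceeding[OF t_mono] by metis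
  have "(\<lambda>n. c * (s (t (l n)) / W (t (l n)))) \<longlonglongrightarrow> c * 0"
    by (intro tendsto_mult tendsto_const filterlim_compose[OF subseq_lim] exceeding(3))
  moreover have "eventually (\<lambda>n. s n / W n \<le> c * (s (t (l n)) / W (t (l n)))) sequentially"
    using eventually_ge_at_top[of "t 0"]
  proof eventually_elim
    case (elim n)
    have "l n \<noteq> 0" using exceeding(1)[of n] elim by (cases "l n") auto
    then obtain j where l_eq: "l n = Suc j" by (cases "l n") auto
    have "t j \<le> n" "n < t (Suc j)" using exceeding(1)[of n] exceeding(2) by (simp_all add: l_eq)
    hence "W (t (l n)) \<le> c * W n" unfolding l_eq by (rule W_le)
    moreover have "W n > 0" "W (t (l n)) > 0" using elim exceeding(1)[of n] by (auto intro!: W_pos)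
    ultimately have "1 / W n \<le> c / W (t (l n))" by (simp add: field_simps)
    moreover have "s n \<le> s (t (l n))"
      using exceeding(1)[of n] by (intro monoD[OF s_mono_nonneg(1)]) simp
    ultimately have "s n * (1 / W n) \<le> s (t (l n)) * (c / W (t (l n)))"
      using s_mono_nonneg(2) \<open>W n > 0\<close> by (intro mult_mono) auto
    thus ?case by (simp add: mult_ac)
  qed
  moreover have "eventually (\<lambda>n. 0 \<le> s n / W n) sequentially"
    using eventually_ge_at_top[of "t 0"]
    by eventually_elim (simp add: s_mono_nonneg(2) W_pos less_imp_le)
  ultimately show ?thesis using tendsto_sandwich[OF _ _ tendsto_const] by simp
qed

lemma tendsto_0_of_bigo:
  fixes f g :: "nat \<Rightarrow> real"
  assumes "f \<in> O(g)" "g \<longlonglongrightarrow> 0"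
  shows "f \<longlonglongrightarrow> 0"
proof -
  have "g \<in> o(\<lambda>_. 1)" using assms(2) by (intro smalloI_tendsto) auto
  from landau_o.big_small_trans[OF assms(1) this] show ?thesis by (auto dest: smalloD_tendsto)
qed

lemma tendsto_1_of_linear_asymptotics:
  fixes x r :: "nat \<Rightarrow> real"
  assumes "(\<lambda>n. x n - (1 + c * r n)) \<in> O(\<lambda>n. (r n)\<^sup>2)" "r \<longlonglongrightarrow> 0"
  shows "x \<longlonglongrightarrow> 1"
proof -
  have "(\<lambda>n. (r n)\<^sup>2) \<longlonglongrightarrow> 0" using tendsto_power[OF assms(2), of 2] by simp
  hence "(\<lambda>n. (x n - (1 + c * r n)) + (1 + c * r n)) \<longlonglongrightarrow> 0 + (1 + c * 0)"
    by (intro tendsto_intros tendsto_0_of_bigo[OF assms(1)] assms(2))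
  thus ?thesis by simp
qed

lemma inverse_asymptotics:
  fixes x r :: "nat \<Rightarrow> real"
  assumes x_asymp: "(\<lambda>n. x n - (1 + c * r n)) \<in> O(\<lambda>n. (r n)\<^sup>2)" and r_lim: "r \<longlonglongrightarrow> 0"
  shows "(\<lambda>n. 1 / x n - (1 - c * r n)) \<in> O(\<lambda>n. (r n)\<^sup>2)"
proof -
  note x_lim = tendsto_1_of_linear_asymptotics[OF x_asymp r_lim]
  have "(\<lambda>n. 1 / x n) \<longlonglongrightarrow> 1" "(\<lambda>n. 1 - c * r n) \<longlonglongrightarrow> 1"
    by (auto intro!: tendsto_eq_intros x_lim r_lim)
  hence bounded: "(\<lambda>n. 1 / x n) \<in> O(\<lambda>_. 1)" "(\<lambda>n. 1 - c * r n) \<in> O(\<lambda>_. 1)"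
    by (auto intro: bigoI_tendsto[of _ _ 1])
  have "(\<lambda>n. c\<^sup>2 * (r n)\<^sup>2 - (1 - c * r n) * (x n - (1 + c * r n))) \<in> O(\<lambda>n. (r n)\<^sup>2)"
    using landau_o.big.mult[OF bounded(2) x_asymp] by (intro sum_in_bigo) auto
  from landau_o.big.mult[OF bounded(1) this]
  have "(\<lambda>n. 1 / x n * (c\<^sup>2 * (r n)\<^sup>2 - (1 - c * r n) * (x n - (1 + c * r n)))) \<in> O(\<lambda>n. (r n)\<^sup>2)"
    by simp
  moreover have "eventually (\<lambda>n. 1 / x n * (c\<^sup>2 * (r n)\<^sup>2 - (1 - c * r n) * (x n - (1 + c * r n)))
      = 1 / x n - (1 - c * r n)) sequentially"
    using order_tendstoD(1)[OF x_lim, of 0]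
    by (auto elim!: eventually_mono simp: field_simps power2_eq_square)
  ultimately show ?thesis by (subst (asm) landau_o.big.in_cong)
qed

lemma le_of_contraction:
  fixes e g :: "'a \<Rightarrow> real" and s :: "'a \<Rightarrow> 'a"
  assumes bounded: "\<And>n. e n \<le> B" and g_nonneg: "\<And>n. g n \<ge> 0" and theta: "0 \<le> \<theta>" "\<theta> < 1" and "D \<ge> 0"
    and step: "\<And>n. n \<notin> N \<Longrightarrow> e n \<le> \<theta> * e (s n) + (1 - \<kappa>) * D * g n \<and> \<theta> * g (s n) \<le> \<kappa> * g n"
    and initial: "\<And>n. n \<in> N \<Longrightarrow> e n \<le> D * g n"
  shows "e n \<le> D * g n"
proof -
  have iterate: "e n \<le> \<theta> ^ m * \<bar>B\<bar> + D * g n" for n m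
  proof (induction m arbitrary: n)
    case 0
    show ?case using bounded[of n] mult_nonneg_nonneg[OF \<open>D \<ge> 0\<close> g_nonneg[of n]] by simp
  next
    case (Suc m)
    show ?case
    proof (cases "n \<in> N")
      case True
      have "0 \<le> \<theta> ^ Suc m * \<bar>B\<bar>" using theta by simp
      with initial[OF True] show ?thesis by linarith
    next
      case False
      have "e n \<le> \<theta> * (\<theta> ^ m * \<bar>B\<bar> + D * g (s n)) + (1 - \<kappa>) * D * g n"
        using step[OF False] mult_left_mono[OF Suc theta(1), of "s n"] by linarith
      also have "\<dots> = \<theta> ^ Suc m * \<bar>B\<bar> + D * (\<theta> * g (s n)) + (1 - \<kappa>) * D * g n"
        by (simp add: algebra_simps)
      also have "\<dots> \<le> \<theta> ^ Suc m * \<bar>B\<bar> + D * (\<kappa> * g n) + (1 - \<kappa>) * D * g n"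
        using step[OF False] \<open>D \<ge> 0\<close> by (intro add_right_mono add_left_mono mult_left_mono) auto
      finally show ?thesis by (simp add: algebra_simps)
    qed
  qed
  show ?thesis
  proof (rule LIMSEQ_le_const)
    have "(\<lambda>m. \<theta> ^ m * \<bar>B\<bar> + D * g n) \<longlonglongrightarrow> 0 * \<bar>B\<bar> + D * g n"
      using theta by (intro tendsto_intros LIMSEQ_power_zero) auto
    thus "(\<lambda>m. \<theta> ^ m * \<bar>B\<bar> + D * g n) \<longlonglongrightarrow> D * g n" by simp
  qed (use iterate in blast)
qed

lemma bigo_of_contraction:
  fixes e g :: "nat \<Rightarrow> real" and s :: "nat \<Rightarrow> nat"
  assumes e_nonneg: "\<And>n. e n \<ge> 0" and "Bseq e" and g_pos: "\<And>n. g n > 0"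
    and theta: "0 \<le> \<theta>" "\<theta> < 1"
    and step: "eventually (\<lambda>n. e n \<le> \<theta> * e (s n) + C * g n) sequentially"
    and ratio: "(\<lambda>n. g (s n) / g n) \<longlonglongrightarrow> 1"
  shows "e \<in> O(g)"
proof -
  obtain B where "\<And>n. norm (e n) \<le> B"
    using \<open>Bseq e\<close> by (elim BseqE) blast
  hence bounded: "e n \<le> B" for n by (simp add: abs_le_iff)
  define \<kappa> where "\<kappa> = (1 + \<theta>) / 2"
  have kappa: "\<kappa> < 1" "\<theta> < \<kappa>" using theta by (simp_all add: \<kappa>_def)
  have "(\<lambda>n. \<theta> * (g (s n) / g n)) \<longlonglongrightarrow> \<theta> * 1" by (intro tendsto_intros ratio)
  hence "eventually (\<lambda>n. \<theta> * (g (s n) / g n) < \<kappa>) sequentially"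
    using kappa by (intro order_tendstoD(2)[of _ "\<theta> * 1"]) auto
  with step have "eventually (\<lambda>n. e n \<le> \<theta> * e (s n) + C * g n \<and> \<theta> * g (s n) \<le> \<kappa> * g n) sequentially"
  proof eventually_elim
    case (elim n)
    thus ?case using g_pos[of n] by (simp add: field_simps)
  qed
  then obtain N where from_N: "e n \<le> \<theta> * e (s n) + C * g n" "\<theta> * g (s n) \<le> \<kappa> * g n" if "n \<ge> N" for n
    unfolding eventually_sequentially by blast
  define D where "D = \<bar>C\<bar> / (1 - \<kappa>) + (\<Sum>n<N. e n / g n)"
  have ratio_nonneg: "0 \<le> e n / g n" for n using e_nonneg[of n] g_pos[of n] by simp
  have D_ge: "0 \<le> D" "\<bar>C\<bar> / (1 - \<kappa>) \<le> D" "(\<Sum>n<N. e n / g n) \<le> D"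
    using kappa ratio_nonneg by (simp_all add: D_def sum_nonneg)
  have "e n \<le> D * g n" for n
  proof (rule le_of_contraction[where N = "{..<N}", OF bounded less_imp_le[OF g_pos] theta D_ge(1)])
    fix n assume "n \<notin> {..<N}"
    have "C * g n \<le> (1 - \<kappa>) * D * g n"
      using D_ge(2) kappa g_pos[of n]
      by (intro mult_right_mono) (auto simp: divide_le_eq mult.commute)
    thus "e n \<le> \<theta> * e (s n) + (1 - \<kappa>) * D * g n \<and> \<theta> * g (s n) \<le> \<kappa> * g n"
      using from_N[of n] \<open>n \<notin> {..<N}\<close> by simp
  next
    fix n assume "n \<in> {..<N}"
    hence "e n / g n \<le> (\<Sum>n<N. e n / g n)" using ratio_nonneg by (intro member_le_sum) auto
    hence "e n / g n \<le> D" using D_ge(3) by linarith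
    thus "e n \<le> D * g n" using g_pos[of n] by (simp add: divide_le_eq)
  qed
  thus ?thesis using e_nonneg g_pos by (intro bigoI[of _ D]) (simp add: less_imp_le)
qed

lemma liminf_limsup_bounds:
  fixes f :: "nat \<Rightarrow> ereal"
  assumes "eventually (\<lambda>n. c \<le> f n \<and> f n \<le> C) sequentially"
  shows "c \<le> liminf f" "liminf f \<le> limsup f" "limsup f \<le> C"
  using assms by (auto intro: Liminf_bounded Limsup_bounded Liminf_le_Limsup elim: eventually_mono)

lemma AE_tendsto_0_of_summable_integral:
  fixes f :: "nat \<Rightarrow> 'a \<Rightarrow> real"
  assumes f_int: "\<And>j. integrable M (f j)" and f_nonneg: "\<And>j \<omega>. f j \<omega> \<ge> 0"
    and summable: "summable (\<lambda>j. integral\<^sup>L M (f j))"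
  shows "AE \<omega> in M. (\<lambda>j. f j \<omega>) \<longlonglongrightarrow> 0"
proof -
  have [measurable]: "f j \<in> borel_measurable M" for j
    using f_int by (rule borel_measurable_integrable)
  have "(\<integral>\<^sup>+\<omega>. (\<Sum>j. ennreal (f j \<omega>)) \<partial>M) = (\<Sum>j. \<integral>\<^sup>+\<omega>. ennreal (f j \<omega>) \<partial>M)"
    by (rule nn_integral_suminf) measurable
  also have "\<dots> = (\<Sum>j. ennreal (integral\<^sup>L M (f j)))"
    using f_int f_nonneg by (intro suminf_cong nn_integral_eq_integral) auto
  also have "\<dots> \<noteq> \<infinity>"
    using summable f_nonneg
    by (simp add: suminf_ennreal_eq[OF _ summable_sums] infinity_ennreal_def)
  finally have "AE \<omega> in M. (\<Sum>j. ennreal (f j \<omega>)) \<noteq> \<infinity>"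
    by (intro nn_integral_PInf_AE) measurable
  thus ?thesis
  proof eventually_elim
    case (elim \<omega>)
    hence "summable (\<lambda>j. f j \<omega>)"
      using f_nonneg by (intro summable_suminf_not_top) (auto simp: infinity_ennreal_def)
    thus ?case by (rule summable_LIMSEQ_zero)
  qed
qed

lemma (in finite_measure) set_integral_between:
  fixes f :: "'a \<Rightarrow> real"
  assumes [measurable]: "A \<in> sets M" and integrable: "set_integrable M A f"
    and between: "AE x\<in>A in M. c \<le> f x \<and> f x \<le> C"
  shows "c * measure M A \<le> (LINT x:A|M. f x)" "(LINT x:A|M. f x) \<le> C * measure M A"
proof -
  have const: "set_integrable M A (\<lambda>_. c)" "(LINT x:A|M. c) = c * measure M A" for c :: real
    by (simp_all add: set_integrable_def set_lebesgue_integral_def emeasure_eq_measure)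
  show "c * measure M A \<le> (LINT x:A|M. f x)" "(LINT x:A|M. f x) \<le> C * measure M A"
    unfolding const(2)[symmetric]
    using between by (auto intro!: set_integral_mono_AE const integrable elim: eventually_mono)
qed

section \<open>The scales\<close>

definition cut_scale :: "real \<Rightarrow> nat \<Rightarrow> real" where
  "cut_scale \<beta> n = real n * ln (ln (real n)) powr \<beta>"

definition count_scale :: "real \<Rightarrow> nat \<Rightarrow> real" where
  "count_scale \<beta> n = ln (real n) * ln (ln (real n)) powr (- \<beta>)"

lemma ln_ln_pos:
  assumes "n \<ge> 4"
  shows "0 < ln (ln (real n))"
proof -
  have "exp (1::real) < 4" using exp_le by simp
  hence "1 < ln (4::real)" by (metis exp_less_cancel_iff exp_ln zero_less_numeral)
  also have "\<dots> \<le> ln (real n)" using assms by simp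
  finally show ?thesis by simp
qed

lemma cut_scale_pos: "n \<ge> 4 \<Longrightarrow> 0 < cut_scale \<beta> n"
  using ln_ln_pos[of n] by (simp add: cut_scale_def)

lemma count_scale_pos: "n \<ge> 4 \<Longrightarrow> 0 < count_scale \<beta> n"
  using ln_ln_pos[of n] by (simp add: count_scale_def)

lemma cut_scale_ratio_tendsto_1: "(\<lambda>n. cut_scale \<beta> (Suc n) / cut_scale \<beta> n) \<longlonglongrightarrow> 1"
  unfolding cut_scale_def by real_asymp

lemma count_scale_at_top: "filterlim (count_scale \<beta>) at_top sequentially"
  unfolding count_scale_def by real_asymp

lemma count_scale_increment_tendsto_1:
  "(\<lambda>n. (count_scale \<beta> (Suc n) - count_scale \<beta> n) * cut_scale \<beta> (Suc n)) \<longlonglongrightarrow> 1"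
  unfolding count_scale_def cut_scale_def by real_asymp

lemma cut_scale_drift_tendsto_1:
  "(\<lambda>n. cut_scale \<beta> n - cut_scale \<beta> (Suc n) * (1 - 3 * r_seq \<beta> (Suc n))) \<longlonglongrightarrow> 1"
  unfolding cut_scale_def r_seq_def Let_def
  by (cases \<beta> "0::real" rule: linorder_cases; hypsubst?; real_asymp)

lemma cut_scale_r_seq_square_tendsto_0:
  "(\<lambda>n. cut_scale \<beta> n * (r_seq \<beta> n)\<^sup>2) \<longlonglongrightarrow> 0"
  unfolding cut_scale_def r_seq_def Let_def
  by (cases \<beta> "0::real" rule: linorder_cases; hypsubst?; real_asymp)

lemma r_seq_pos: "0 < r_seq \<beta> n"
  using ln_ln_pos[of "max n 4"] by (simp add: r_seq_def Let_def add_pos_pos)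

lemma r_seq_tendsto_0: "r_seq \<beta> \<longlonglongrightarrow> 0"
  unfolding r_seq_def Let_def by real_asymp

lemma r_seq_Suc_diff_bigo: "(\<lambda>n. r_seq \<beta> (Suc n) - r_seq \<beta> n) \<in> O(\<lambda>n. (r_seq \<beta> n)\<^sup>2)"
  unfolding r_seq_def Let_def
  by (cases \<beta> "0::real" rule: linorder_cases; hypsubst?; real_asymp)

lemma r_seq_pred_diff_bigo: "(\<lambda>n. r_seq \<beta> (n - 1) - r_seq \<beta> n) \<in> O(\<lambda>n. (r_seq \<beta> n)\<^sup>2)"
  unfolding r_seq_def Let_def
  by (cases \<beta> "0::real" rule: linorder_cases; hypsubst?; real_asymp)

lemma sum_order_count_scale:
  fixes x :: "nat \<Rightarrow> real"
  assumes "0 < c" "0 < C"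
    and x_order: "eventually (\<lambda>k. c / cut_scale \<beta> k \<le> x k \<and> x k \<le> C / cut_scale \<beta> k) sequentially"
  shows "eventually (\<lambda>n. c / 4 * count_scale \<beta> n \<le> (\<Sum>k=2..n. x k) \<and>
    (\<Sum>k=2..n. x k) \<le> 4 * C * count_scale \<beta> n) sequentially"
proof -
  have sum_increment: "(\<Sum>k=2..Suc n. x k) - (\<Sum>k=2..n. x k) = x (Suc n)" if "n \<ge> 1" for n
    using that by simp
  have x_Suc: "eventually (\<lambda>k. c / cut_scale \<beta> (Suc k) \<le> x (Suc k) \<and>
      x (Suc k) \<le> C / cut_scale \<beta> (Suc k)) sequentially"
    using eventually_compose_filterlim[OF x_order filterlim_Suc] .
  have lower: "eventually (\<lambda>n.
      1 / 2 < (count_scale \<beta> (Suc n) - count_scale \<beta> n) * cut_scale \<beta> (Suc n)) sequentially"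
    and upper: "eventually (\<lambda>n.
      (count_scale \<beta> (Suc n) - count_scale \<beta> n) * cut_scale \<beta> (Suc n) < 2) sequentially"
    by (rule order_tendstoD[OF count_scale_increment_tendsto_1]; simp)+
  have increments: "eventually (\<lambda>n.
      c / 2 * (count_scale \<beta> (Suc n) - count_scale \<beta> n) \<le> (\<Sum>k=2..Suc n. x k) - (\<Sum>k=2..n. x k) \<and>
      (\<Sum>k=2..Suc n. x k) - (\<Sum>k=2..n. x k) \<le> 2 * C * (count_scale \<beta> (Suc n) - count_scale \<beta> n))
      sequentially"
    using x_Suc lower upper eventually_ge_at_top[of 4]
  proof eventually_elim
    case (elim n)
    define V d where "V = cut_scale \<beta> (Suc n)" and "d = count_scale \<beta> (Suc n) - count_scale \<beta> n"
    have V_pos: "V > 0" unfolding V_def using elim by (intro cut_scale_pos) simp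
    have "d * V < 2" "1 / 2 < d * V" using elim by (simp_all add: V_def d_def)
    hence "c / 2 * (d * V) \<le> c" "C \<le> 2 * C * (d * V)"
      using \<open>0 < c\<close> \<open>0 < C\<close> by (simp_all add: field_simps)
    hence "c / 2 * d \<le> c / V" "C / V \<le> 2 * C * d" using V_pos by (simp_all add: field_simps)
    moreover have "c / V \<le> x (Suc n)" "x (Suc n) \<le> C / V" using elim by (simp_all add: V_def)
    moreover have "(\<Sum>k=2..Suc n. x k) - (\<Sum>k=2..n. x k) = x (Suc n)"
      using elim by (intro sum_increment) simp
    ultimately show ?case unfolding d_def[symmetric] by linarith
  qed
  have "eventually (\<lambda>n. c / 4 * count_scale \<beta> n \<le> (\<Sum>k=2..n. x k)) sequentially"
    by (rule stolz_cesaro_ge[where c = "c / 2", OF count_scale_at_top eventually_mono[OF increments]])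
      (use assms in auto)
  moreover have "eventually (\<lambda>n. (\<Sum>k=2..n. x k) \<le> 4 * C * count_scale \<beta> n) sequentially"
    by (rule stolz_cesaro_le[where c = "2 * C", OF count_scale_at_top eventually_mono[OF increments]])
      (use assms in auto)
  ultimately show ?thesis by (rule eventually_conj)
qed

lemma not_summable_inverse_cut_scale: "\<not> summable (\<lambda>n. 1 / cut_scale \<beta> n)"
proof
  let ?S = "\<lambda>n. \<Sum>k=2..n. 1 / cut_scale \<beta> k"
  assume summable: "summable (\<lambda>n. 1 / cut_scale \<beta> n)"
  have "eventually (\<lambda>n. 1 / 4 * count_scale \<beta> n \<le> ?S n) sequentially"
    using sum_order_count_scale[of 1 1 \<beta> "\<lambda>k. 1 / cut_scale \<beta> k"] by (auto elim: eventually_mono)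
  moreover have "filterlim (\<lambda>n. 1 / 4 * count_scale \<beta> n) at_top sequentially"
    by (rule filterlim_tendsto_pos_mult_at_top[OF tendsto_const _ count_scale_at_top]) simp
  ultimately have "filterlim ?S at_top sequentially" by (rule filterlim_at_top_mono[rotated])
  hence "eventually (\<lambda>n. ?S n > (\<Sum>n. 1 / cut_scale \<beta> n)) sequentially"
    by (simp add: filterlim_at_top_dense)
  moreover have "?S n \<le> (\<Sum>n. 1 / cut_scale \<beta> n)" for n
    using summable by (rule sum_le_suminf) (auto simp: cut_scale_def)
  ultimately show False by (auto simp: not_less[symmetric])
qed

lemma tendsto_0_if_not_summable_inverse:
  fixes u V :: "nat \<Rightarrow> real"
  assumes "summable u" and V_pos: "eventually (\<lambda>n. V n > 0) sequentially"
    and "\<not> summable (\<lambda>n. 1 / V n)"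
    and u_nonneg: "\<And>n. u n \<ge> 0" and "convergent (\<lambda>n. u n * V n)"
  shows "(\<lambda>n. u n * V n) \<longlonglongrightarrow> 0"
proof -
  obtain l where limit: "(\<lambda>n. u n * V n) \<longlonglongrightarrow> l" using assms(5) by (auto simp: convergent_def)
  have "eventually (\<lambda>n. 0 \<le> u n * V n) sequentially"
    using V_pos by eventually_elim (simp add: u_nonneg)
  with limit have "l \<ge> 0" by (rule tendsto_lowerbound) simp
  moreover have "\<not> l > 0"
  proof
    assume "l > 0"
    hence "eventually (\<lambda>n. u n * V n > l / 2) sequentially" by (intro order_tendstoD[OF limit]) simp
    with V_pos have "eventually (\<lambda>n. norm (1 / V n) \<le> 2 / l * u n) sequentially"
      by eventually_elim (use \<open>l > 0\<close> in \<open>simp add: field_simps\<close>)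
    from summable_comparison_test_ev[OF this summable_mult[OF \<open>summable u\<close>]] show False
      using assms(3) by blast
  qed
  ultimately show ?thesis using limit by simp
qed

lemma cut_scale_increment_quotient_tendsto_1:
  fixes u :: "nat \<Rightarrow> real"
  assumes u_pos: "\<And>n. u n > 0"
    and ratio: "(\<lambda>n. u n / u (n - 1) - (1 - 3 * r_seq \<beta> n)) \<in> O(\<lambda>n. (r_seq \<beta> n)\<^sup>2)"
  shows "(\<lambda>n. (u n * cut_scale \<beta> n - u (Suc n) * cut_scale \<beta> (Suc n)) / u n) \<longlonglongrightarrow> 1"
proof -
  have "(\<lambda>n. cut_scale \<beta> n * (u n / u (n - 1) - (1 - 3 * r_seq \<beta> n)))
      \<in> O(\<lambda>n. cut_scale \<beta> n * (r_seq \<beta> n)\<^sup>2)"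
    using ratio by (intro landau_o.big.mult_left)
  from tendsto_0_of_bigo[OF this cut_scale_r_seq_square_tendsto_0]
  have "(\<lambda>n. cut_scale \<beta> (Suc n) * (u (Suc n) / u n - (1 - 3 * r_seq \<beta> (Suc n)))) \<longlonglongrightarrow> 0"
    by (subst (asm) filterlim_sequentially_Suc[symmetric]) simp
  from tendsto_diff[OF cut_scale_drift_tendsto_1[of \<beta>] this]
  have "(\<lambda>n. cut_scale \<beta> n - cut_scale \<beta> (Suc n) * (u (Suc n) / u n)) \<longlonglongrightarrow> 1"
    by (simp add: algebra_simps)
  also have "(\<lambda>n. cut_scale \<beta> n - cut_scale \<beta> (Suc n) * (u (Suc n) / u n))
      = (\<lambda>n. (u n * cut_scale \<beta> n - u (Suc n) * cut_scale \<beta> (Suc n)) / u n)"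
    using u_pos by (auto simp: field_simps less_imp_neq[symmetric])
  finally show ?thesis .
qed

lemma cut_scale_tail_sum_tendsto_1:
  fixes u :: "nat \<Rightarrow> real"
  assumes u_pos: "\<And>n. u n > 0"
    and "(\<lambda>n. u n / u (n - 1) - (1 - 3 * r_seq \<beta> n)) \<in> O(\<lambda>n. (r_seq \<beta> n)\<^sup>2)"
  shows "summable u" "(\<lambda>k. u k * cut_scale \<beta> k / tail_sum u k) \<longlonglongrightarrow> 1"
proof -
  note quotient = cut_scale_increment_quotient_tendsto_1[OF assms]
  have scale_pos: "eventually (\<lambda>n. cut_scale \<beta> n > 0) sequentially"
    using eventually_ge_at_top[of 4] by eventually_elim (rule cut_scale_pos)
  hence nonneg: "eventually (\<lambda>n. u n * cut_scale \<beta> n \<ge> 0) sequentially"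
    by eventually_elim (simp add: u_pos less_imp_le)
  show summable: "summable u"
    by (rule summable_convergent_if_increment_quotient(1)[OF u_pos nonneg quotient]) simp
  have "convergent (\<lambda>n. u n * cut_scale \<beta> n)"
    by (rule summable_convergent_if_increment_quotient(2)[OF u_pos nonneg quotient]) simp
  hence "(\<lambda>n. u n * cut_scale \<beta> n) \<longlonglongrightarrow> 0"
    by (rule tendsto_0_if_not_summable_inverse[OF summable scale_pos
        not_summable_inverse_cut_scale less_imp_le[OF u_pos]])
  from stolz_cesaro_tail_sum[OF u_pos summable this quotient]
  show "(\<lambda>k. u k * cut_scale \<beta> k / tail_sum u k) \<longlonglongrightarrow> 1" .
qed

definition as_scale :: "real \<Rightarrow> real \<Rightarrow> nat \<Rightarrow> real" where
  "as_scale \<beta> \<epsilon> n = ln (real n) powr (1 + \<epsilon>) * ln (ln (real n)) powr (- \<beta>)"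

lemma as_scale_pos: "n \<ge> 4 \<Longrightarrow> 0 < as_scale \<beta> \<epsilon> n"
  using ln_ln_pos[of n] by (simp add: as_scale_def)

lemma as_scale_le_of_ln_le:
  assumes "0 \<le> \<beta>" "0 \<le> \<epsilon>" "4 \<le> n" "n \<le> m" and "ln (real m) \<le> 2 * ln (real n)"
  shows "as_scale \<beta> \<epsilon> m \<le> 2 powr (1 + \<epsilon>) * as_scale \<beta> \<epsilon> n"
proof -
  have "ln (real m) powr (1 + \<epsilon>) \<le> (2 * ln (real n)) powr (1 + \<epsilon>)"
    using assms by (intro powr_mono2) auto
  moreover have "ln (ln (real m)) powr (- \<beta>) \<le> ln (ln (real n)) powr (- \<beta>)"
    using assms ln_ln_pos[of n] by (intro powr_mono2') auto
  ultimately have "as_scale \<beta> \<epsilon> m \<le> (2 * ln (real n)) powr (1 + \<epsilon>) * ln (ln (real n)) powr (- \<beta>)"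
    unfolding as_scale_def by (intro mult_mono) auto
  also have "\<dots> = 2 powr (1 + \<epsilon>) * as_scale \<beta> \<epsilon> n"
    using assms by (simp add: as_scale_def powr_mult)
  finally show ?thesis .
qed

lemma count_scale_div_as_scale:
  assumes "n \<ge> 4"
  shows "count_scale \<beta> n / as_scale \<beta> \<epsilon> n = ln (real n) powr (- \<epsilon>)"
  using assms ln_ln_pos[OF assms]
  by (simp add: count_scale_def as_scale_def powr_add powr_minus field_simps)

definition double_exp :: "nat \<Rightarrow> nat" where
  "double_exp j = 2 ^ 2 ^ Suc j"

lemma strict_mono_double_exp: "strict_mono double_exp"
  by (simp add: strict_mono_Suc_iff double_exp_def)

lemma double_exp_ge_4: "double_exp j \<ge> 4"
  using strict_mono_less_eq[OF strict_mono_double_exp, of 0 j] by (simp add: double_exp_def)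

lemma ln_double_exp: "ln (real (double_exp j)) = 2 ^ Suc j * ln 2"
  by (simp add: double_exp_def ln_realpow)

lemma summable_ln_double_exp_powr:
  assumes "\<epsilon> > 0"
  shows "summable (\<lambda>j. ln (real (double_exp j)) powr (- \<epsilon>))"
proof -
  have "ln (real (double_exp j)) powr (- \<epsilon>) = (2 powr (- \<epsilon>)) ^ Suc j * ln 2 powr (- \<epsilon>)" for j
    unfolding ln_double_exp
    by (simp add: powr_mult powr_power powr_powr mult.commute flip: powr_realpow)
  moreover have "summable (\<lambda>j. (2 powr (- \<epsilon>)) ^ Suc j * ln 2 powr (- \<epsilon>))"
    using assms by (intro summable_mult2 summable_Suc_iff[THEN iffD2] summable_geometric)
      (simp add: powr_minus field_simps)
  ultimately show ?thesis by simp
qed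

lemma summable_count_scale_div_as_scale_double_exp:
  assumes "\<epsilon> > 0" and nonneg: "\<And>n. x n \<ge> 0"
    and bound: "eventually (\<lambda>n. x n \<le> K * count_scale \<beta> n) sequentially"
  shows "summable (\<lambda>j. x (double_exp j) / as_scale \<beta> \<epsilon> (double_exp j))"
proof (rule summable_comparison_test_ev)
  have "eventually (\<lambda>j. x (double_exp j) \<le> K * count_scale \<beta> (double_exp j)) sequentially"
    by (rule eventually_compose_filterlim[OF bound filterlim_subseq[OF strict_mono_double_exp]])
  thus "eventually (\<lambda>j. norm (x (double_exp j) / as_scale \<beta> \<epsilon> (double_exp j)) \<le>
      K * ln (real (double_exp j)) powr (- \<epsilon>)) sequentially"
  proof eventually_elim
    case (elim j)
    have scale_pos: "as_scale \<beta> \<epsilon> (double_exp j) > 0" by (rule as_scale_pos[OF double_exp_ge_4])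
    have "x (double_exp j) / as_scale \<beta> \<epsilon> (double_exp j) \<le>
        K * (count_scale \<beta> (double_exp j) / as_scale \<beta> \<epsilon> (double_exp j))"
      using elim scale_pos by (simp add: divide_right_mono)
    thus ?case
      using nonneg[of "double_exp j"] scale_pos
      unfolding count_scale_div_as_scale[OF double_exp_ge_4] by simp
  qed
  show "summable (\<lambda>j. K * ln (real (double_exp j)) powr (- \<epsilon>))"
    by (intro summable_mult summable_ln_double_exp_powr \<open>\<epsilon> > 0\<close>)
qed

lemma AE_div_as_scale_tendsto_0:
  fixes S :: "nat \<Rightarrow> 'a \<Rightarrow> real"
  assumes "0 \<le> \<beta>" "\<epsilon> > 0"
    and S_int: "\<And>n. integrable M (S n)" and S_nonneg: "\<And>n \<omega>. S n \<omega> \<ge> 0"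
    and S_mono: "\<And>\<omega>. mono (\<lambda>n. S n \<omega>)"
    and bound: "eventually (\<lambda>n. integral\<^sup>L M (S n) \<le> K * count_scale \<beta> n) sequentially"
  shows "AE \<omega> in M. (\<lambda>n. S n \<omega> / as_scale \<beta> \<epsilon> n) \<longlonglongrightarrow> 0"
proof -
  define f where "f j \<omega> = S (double_exp j) \<omega> / as_scale \<beta> \<epsilon> (double_exp j)" for j \<omega>
  have "AE \<omega> in M. (\<lambda>j. f j \<omega>) \<longlonglongrightarrow> 0"
  proof (rule AE_tendsto_0_of_summable_integral)
    show "integrable M (f j)" for j unfolding f_def using S_int by simp
    show "f j \<omega> \<ge> 0" for j \<omega>
      unfolding f_def using S_nonneg as_scale_pos[OF double_exp_ge_4] by (simp add: less_imp_le)
    show "summable (\<lambda>j. integral\<^sup>L M (f j))"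
      using summable_count_scale_div_as_scale_double_exp[OF \<open>\<epsilon> > 0\<close> _ bound] S_nonneg
      by (simp add: f_def[abs_def])
  qed
  thus ?thesis
  proof eventually_elim
    case (elim \<omega>)
    show ?case
    proof (rule mono_ratio_tendsto_0_of_subseq[OF S_mono S_nonneg strict_mono_double_exp])
      show "as_scale \<beta> \<epsilon> n > 0" if "n \<ge> double_exp 0" for n
        using that double_exp_ge_4[of 0] by (intro as_scale_pos) simp
      show "as_scale \<beta> \<epsilon> (double_exp (Suc j)) \<le> 2 powr (1 + \<epsilon>) * as_scale \<beta> \<epsilon> n"
        if "double_exp j \<le> n" "n < double_exp (Suc j)" for j n
      proof (rule as_scale_le_of_ln_le)
        have "ln (real (double_exp (Suc j))) = 2 * ln (real (double_exp j))"
          by (simp add: ln_double_exp)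
        also have "\<dots> \<le> 2 * ln (real n)" using that double_exp_ge_4[of j] by simp
        finally show "ln (real (double_exp (Suc j))) \<le> 2 * ln (real n)" .
      qed (use assms(1,2) that double_exp_ge_4[of j] in auto)
    qed (use elim in \<open>simp add: f_def\<close>)
  qed
qed

section \<open>Positive solutions of the harmonic recursion\<close>

lemma continued_fraction_upper:
  fixes a b x :: "nat \<Rightarrow> real" and s :: "nat \<Rightarrow> nat"
  assumes coeff_lim: "a \<longlonglongrightarrow> a0" "b \<longlonglongrightarrow> b0" and s_at_top: "filterlim s at_top sequentially"
    and limit_bounds: "0 < b0" "b0 \<le> a0" "a0 \<le> 1"
    and x_pos: "\<And>n. x n > 0"
    and recursion: "eventually (\<lambda>n. x n = a n + b n / x (s n)) sequentially"
  shows "eventually (\<lambda>n. x n \<le> 3) sequentially"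
proof -
  have b_pos: "eventually (\<lambda>n. b n > 0) sequentially"
    and a_pos: "eventually (\<lambda>n. a n > 0) sequentially"
    using coeff_lim limit_bounds by (auto intro: order_tendstoD)
  have "eventually (\<lambda>n. 0 < a n \<and> a n \<le> x n) sequentially"
    using recursion a_pos b_pos
  proof eventually_elim
    case (elim n)
    thus ?case using x_pos[of "s n"] by simp
  qed
  hence a_le_x: "eventually (\<lambda>n. 0 < a (s n) \<and> a (s n) \<le> x (s n)) sequentially"
    by (rule eventually_compose_filterlim) (rule s_at_top)
  have "(\<lambda>n. a n + b n / a (s n)) \<longlonglongrightarrow> a0 + b0 / a0"
    using limit_bounds
    by (intro tendsto_intros coeff_lim filterlim_compose[OF coeff_lim(1) s_at_top]) auto
  moreover have "b0 / a0 \<le> 1" using limit_bounds by simp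
  hence "a0 + b0 / a0 < 3" using limit_bounds by linarith
  ultimately have "eventually (\<lambda>n. a n + b n / a (s n) < 3) sequentially" by (rule order_tendstoD)
  thus ?thesis
    using a_le_x b_pos recursion
  proof eventually_elim
    case (elim n)
    have "b n / x (s n) \<le> b n / a (s n)" using elim by (intro divide_left_mono) auto
    thus ?case using elim(1,4) by linarith
  qed
qed

text \<open>The bound \<open>a n \<le> x n\<close> does not make \<open>t \<mapsto> a n + b n / t\<close> a contraction near \<open>1\<close>, since
  \<open>a0 = b0\<close> is possible; any lower bound by more than \<open>b0\<close> does.\<close>

lemma continued_fraction_lower:
  fixes a b x :: "nat \<Rightarrow> real" and s :: "nat \<Rightarrow> nat"
  assumes coeff_lim: "a \<longlonglongrightarrow> a0" "b \<longlonglongrightarrow> b0" and s_at_top: "filterlim s at_top sequentially"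
    and limit_bounds: "0 < b0" "b0 \<le> a0"
    and x_pos: "\<And>n. x n > 0"
    and recursion: "eventually (\<lambda>n. x n = a n + b n / x (s n)) sequentially"
    and upper: "eventually (\<lambda>n. x n \<le> 3) sequentially"
  shows "eventually (\<lambda>n. 7 / 6 * b0 \<le> x n) sequentially"
proof -
  have "(\<lambda>n. a n + b n / 3) \<longlonglongrightarrow> a0 + b0 / 3" by (intro tendsto_intros coeff_lim) auto
  moreover have "7 / 6 * b0 < a0 + b0 / 3" using limit_bounds by linarith
  ultimately have "eventually (\<lambda>n. 7 / 6 * b0 < a n + b n / 3) sequentially"
    by (rule order_tendstoD)
  moreover have "eventually (\<lambda>n. b n > 0) sequentially"
    using coeff_lim(2) limit_bounds(1) by (rule order_tendstoD)
  ultimately show ?thesis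
    using eventually_compose_filterlim[OF upper s_at_top] recursion
  proof eventually_elim
    case (elim n)
    have "b n / 3 \<le> b n / x (s n)" using elim x_pos[of "s n"] by (intro divide_left_mono) auto
    thus ?case using elim(1,4) by linarith
  qed
qed

lemma continued_fraction_contraction:
  fixes a b x \<rho> :: "nat \<Rightarrow> real" and s :: "nat \<Rightarrow> nat"
  assumes limits: "b \<longlonglongrightarrow> b0" "\<rho> \<longlonglongrightarrow> 1" and s_at_top: "filterlim s at_top sequentially" and "0 < b0"
    and recursion: "eventually (\<lambda>n. x n = a n + b n / x (s n)) sequentially"
    and fixed_point: "eventually (\<lambda>n. \<rho> n = a n + b n / \<rho> n) sequentially"
    and lower: "eventually (\<lambda>n. 7 / 6 * b0 \<le> x n) sequentially"
  shows "eventually (\<lambda>n. \<bar>x n - \<rho> n\<bar> \<le> 13 / 14 * \<bar>x (s n) - \<rho> n\<bar>) sequentially"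
proof -
  have "(\<lambda>n. b n / \<rho> n) \<longlonglongrightarrow> b0 / 1"
    by (intro tendsto_intros limits) auto
  hence "eventually (\<lambda>n. b n / \<rho> n < 13 / 12 * b0) sequentially"
    using \<open>0 < b0\<close> by (intro order_tendstoD) auto
  moreover have "eventually (\<lambda>n. \<rho> n > 0) sequentially" "eventually (\<lambda>n. b n > 0) sequentially"
    using limits \<open>0 < b0\<close> by (auto intro: order_tendstoD)
  ultimately show ?thesis
    using recursion fixed_point eventually_compose_filterlim[OF lower s_at_top]
  proof eventually_elim
    case (elim n)
    have x_pos: "x (s n) > 0" using elim(6) \<open>0 < b0\<close> by linarith
    have "x n - \<rho> n = b n / x (s n) - b n / \<rho> n" using elim(4,5) by linarith
    also have "\<dots> = - (b n / \<rho> n / x (s n)) * (x (s n) - \<rho> n)"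
      using elim(2) x_pos by (simp add: field_simps)
    finally have "\<bar>x n - \<rho> n\<bar> = b n / \<rho> n / x (s n) * \<bar>x (s n) - \<rho> n\<bar>"
      using elim(2,3) x_pos by (simp add: abs_mult)
    also have "\<dots> \<le> 13 / 14 * \<bar>x (s n) - \<rho> n\<bar>"
    proof (rule mult_right_mono)
      have "b n / \<rho> n / x (s n) \<le> (13 / 12 * b0) / (7 / 6 * b0)"
        using elim(1,2,3,6) \<open>0 < b0\<close> by (intro frac_le) auto
      thus "b n / \<rho> n / x (s n) \<le> 13 / 14" using \<open>0 < b0\<close> by simp
    qed simp
    finally show ?case .
  qed
qed

locale slowly_varying =
  fixes r :: "nat \<Rightarrow> real" and s :: "nat \<Rightarrow> nat"
  assumes r_pos: "\<And>n. r n > 0" and r_tendsto_0: "r \<longlonglongrightarrow> 0"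
    and s_at_top: "filterlim s at_top sequentially"
    and r_shift_diff: "(\<lambda>n. r (s n) - r n) \<in> O(\<lambda>n. (r n)\<^sup>2)"
begin

lemma r_nonzero [simp]: "r n \<noteq> 0"
  using r_pos[of n] by simp

lemma ratio_tendsto_1: "(\<lambda>n. r (s n) / r n) \<longlonglongrightarrow> 1"
proof -
  have "(\<lambda>n. (r (s n) - r n) / r n) \<in> O(\<lambda>n. (r n)\<^sup>2 / r n)"
    using r_shift_diff by (intro landau_o.big.divide_right) simp_all
  also have "(\<lambda>n. (r n)\<^sup>2 / r n) = r" by (auto simp: power2_eq_square)
  also have "r \<in> o(\<lambda>_. 1)" using r_tendsto_0 by (intro smalloI_tendsto) auto
  finally have "(\<lambda>n. (r (s n) - r n) / r n) \<longlonglongrightarrow> 0" by (auto dest: smalloD_tendsto)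
  from tendsto_add[OF this tendsto_const[of 1]] show ?thesis
    by (simp add: diff_divide_distrib)
qed

lemma shift_bigo_square:
  assumes "f \<in> O(\<lambda>n. (r n)\<^sup>2)"
  shows "(\<lambda>n. f (s n)) \<in> O(\<lambda>n. (r n)\<^sup>2)"
proof -
  have "(\<lambda>n. f (s n)) \<in> O(\<lambda>n. (r (s n))\<^sup>2)"
    using landau_o.big.compose[OF assms s_at_top] .
  also have "(\<lambda>n. r (s n)) \<in> O(r)"
    using ratio_tendsto_1 by (intro bigoI_tendsto[of _ _ 1]) simp_all
  hence "(\<lambda>n. (r (s n))\<^sup>2) \<in> O(\<lambda>n. (r n)\<^sup>2)" by (rule landau_o.big_power)
  finally show ?thesis .
qed

lemma shift_diff_bigo_square:
  assumes "(\<lambda>n. f n - (1 + c * r n)) \<in> O(\<lambda>n. (r n)\<^sup>2)"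
  shows "(\<lambda>n. f (s n) - f n) \<in> O(\<lambda>n. (r n)\<^sup>2)"
proof -
  define e where "e n = f n - (1 + c * r n)" for n
  have "e \<in> O(\<lambda>n. (r n)\<^sup>2)" using assms unfolding e_def .
  hence "(\<lambda>n. e (s n) - e n + c * (r (s n) - r n)) \<in> O(\<lambda>n. (r n)\<^sup>2)"
    using landau_o.big.mult[OF _ r_shift_diff, of "\<lambda>_. c" "\<lambda>_. 1"]
    by (intro sum_in_bigo shift_bigo_square) simp_all
  also have "(\<lambda>n. e (s n) - e n + c * (r (s n) - r n)) = (\<lambda>n. f (s n) - f n)"
    by (auto simp: e_def algebra_simps)
  finally show ?thesis .
qed

lemma continued_fraction_asymptotics:
  fixes a b x \<rho> :: "nat \<Rightarrow> real"
  assumes coeff_lim: "a \<longlonglongrightarrow> a0" "b \<longlonglongrightarrow> b0" and limit_bounds: "0 < b0" "b0 \<le> a0" "a0 \<le> 1"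
    and x_pos: "\<And>n. x n > 0"
    and recursion: "eventually (\<lambda>n. x n = a n + b n / x (s n)) sequentially"
    and fixed_point: "eventually (\<lambda>n. \<rho> n = a n + b n / \<rho> n) sequentially"
    and \<rho>_asymp: "(\<lambda>n. \<rho> n - (1 + c * r n)) \<in> O(\<lambda>n. (r n)\<^sup>2)"
  shows "(\<lambda>n. x n - (1 + c * r n)) \<in> O(\<lambda>n. (r n)\<^sup>2)"
proof -
  note \<rho>_lim = tendsto_1_of_linear_asymptotics[OF \<rho>_asymp r_tendsto_0]
  note upper = continued_fraction_upper[OF coeff_lim s_at_top limit_bounds x_pos recursion]
  note lower = continued_fraction_lower[OF coeff_lim s_at_top limit_bounds(1,2) x_pos recursion
    upper]
  obtain C where shift_bound: "eventually (\<lambda>n. norm (\<rho> (s n) - \<rho> n) \<le>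
      C * norm ((r n)\<^sup>2)) sequentially"
    using shift_diff_bigo_square[OF \<rho>_asymp] by (elim landau_o.bigE)
  have "(\<lambda>n. \<bar>x n - \<rho> n\<bar>) \<in> O(\<lambda>n. (r n)\<^sup>2)"
  proof (rule bigo_of_contraction[where \<theta> = "13 / 14" and C = "13 / 14 * C"])
    show "eventually (\<lambda>n. \<bar>x n - \<rho> n\<bar> \<le>
        13 / 14 * \<bar>x (s n) - \<rho> (s n)\<bar> + 13 / 14 * C * (r n)\<^sup>2) sequentially"
      using continued_fraction_contraction[OF coeff_lim(2) \<rho>_lim s_at_top limit_bounds(1) recursion
        fixed_point lower] shift_bound
    proof eventually_elim
      case (elim n)
      have "\<bar>x (s n) - \<rho> n\<bar> \<le> \<bar>x (s n) - \<rho> (s n)\<bar> + C * (r n)\<^sup>2" using elim(2) by simp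
      thus ?case using elim(1) by simp
    qed
    have "eventually (\<lambda>n. \<rho> n > 0) sequentially" "eventually (\<lambda>n. \<rho> n < 2) sequentially"
      using \<rho>_lim by (auto intro: order_tendstoD)
    with upper have "eventually (\<lambda>n. norm \<bar>x n - \<rho> n\<bar> \<le> norm (3 :: real)) sequentially"
    proof eventually_elim
      case (elim n)
      thus ?case using x_pos[of n] by simp
    qed
    thus "Bseq (\<lambda>n. \<bar>x n - \<rho> n\<bar>)" by (rule Bseq_eventually_mono) simp
    show "(\<lambda>n. (r (s n))\<^sup>2 / (r n)\<^sup>2) \<longlonglongrightarrow> 1"
      using tendsto_power[OF ratio_tendsto_1, of 2] by (simp add: power_divide)
  qed (use r_pos in auto)
  hence "(\<lambda>n. x n - \<rho> n) \<in> O(\<lambda>n. (r n)\<^sup>2)" by simp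
  from sum_in_bigo(1)[OF this \<rho>_asymp] show ?thesis by (simp add: algebra_simps)
qed

end

lemma positive_truncated_solution:
  fixes a b :: "nat \<Rightarrow> real"
  assumes "\<And>n. a n > 0" "\<And>n. b n > 0"
  shows "\<exists>d. (\<forall>n. d n > 0) \<and> (\<forall>n<N. d n = a n * d (Suc n) + b n * d (Suc (Suc n)))"
  using assms
proof (induction N arbitrary: a b)
  case 0
  show ?case by (intro exI[of _ "\<lambda>_. 1"]) simp
next
  case (Suc N)
  obtain d where d_pos: "\<And>n. d n > 0"
    and recursion: "\<And>n. n < N \<Longrightarrow> d n = a (Suc n) * d (Suc n) + b (Suc n) * d (Suc (Suc n))"
    using Suc.IH[of "\<lambda>n. a (Suc n)" "\<lambda>n. b (Suc n)"] Suc.prems by blast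
  define d' where "d' = case_nat (a 0 * d 0 + b 0 * d 1) d"
  have "d' n > 0" for n
    using d_pos Suc.prems by (cases n) (auto simp: d'_def add_pos_pos)
  moreover have "d' n = a n * d' (Suc n) + b n * d' (Suc (Suc n))" if "n < Suc N" for n
    using that recursion by (cases n) (auto simp: d'_def)
  ultimately show ?case by blast
qed

fun solution_from_slope :: "(nat \<Rightarrow> real) \<Rightarrow> (nat \<Rightarrow> real) \<Rightarrow> real \<Rightarrow> nat \<Rightarrow> real" where
  "solution_from_slope a b t 0 = 1"
| "solution_from_slope a b t (Suc 0) = t"
| "solution_from_slope a b t (Suc (Suc n)) =
    (solution_from_slope a b t n - a n * solution_from_slope a b t (Suc n)) / b n"

lemma continuous_solution_from_slope:
  assumes "\<And>n. b n \<noteq> 0"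
  shows "continuous_on UNIV (\<lambda>t. solution_from_slope a b t n)"
  by (induction n rule: induct_nat_012) (auto intro!: continuous_intros simp: assms)

lemma solution_from_slope_unique:
  assumes "\<And>n. b n \<noteq> 0" "d 0 \<noteq> 0"
    and recursion: "\<And>n. n < N \<Longrightarrow> d n = a n * d (Suc n) + b n * d (Suc (Suc n))"
  shows "n \<le> Suc N \<Longrightarrow> solution_from_slope a b (d 1 / d 0) n = d n / d 0"
proof (induction n rule: induct_nat_012)
  case (ge2 n)
  have "d (Suc (Suc n)) = (d n - a n * d (Suc n)) / b n"
    using recursion[of n] assms(1)[of n] ge2 by simp
  thus ?case using ge2 by (simp add: diff_divide_distrib mult.commute)
qed (use assms in auto)

lemma nonneg_solution_pos:
  fixes a b d :: "nat \<Rightarrow> real"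
  assumes a_pos: "\<And>n. a n > 0" and b_pos: "\<And>n. b n > 0"
    and d_nonneg: "\<And>n. d n \<ge> 0" and "d 0 \<noteq> 0"
    and recursion: "\<And>n. d n = a n * d (Suc n) + b n * d (Suc (Suc n))"
  shows "d n > 0"
proof (rule ccontr)
  assume "\<not> d n > 0"
  hence "d n = 0" using d_nonneg[of n] by simp
  have "a n * d (Suc n) \<ge> 0" "b n * d (Suc (Suc n)) \<ge> 0"
    by (intro mult_nonneg_nonneg d_nonneg less_imp_le[OF a_pos] less_imp_le[OF b_pos])+
  hence "d (Suc n) = 0"
    using recursion[of n] \<open>d n = 0\<close> a_pos[of n] by (simp add: add_nonneg_eq_0_iff)
  have "d m = 0 \<and> d (Suc m) = 0" if "m \<le> n" for m
    using that
  proof (induction rule: inc_induct)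
    case (step m)
    thus ?case using recursion[of m] by simp
  qed (simp add: \<open>d n = 0\<close> \<open>d (Suc n) = 0\<close>)
  from this[of 0] show False using \<open>d 0 \<noteq> 0\<close> by simp
qed

text \<open>The dominant root of the forward recursion has alternating sign, so a solution started from
  \<open>d 0 = 1\<close> is positive only for a single slope \<open>d 1\<close>: a limit of the slopes of truncated solutions.\<close>

lemma positive_backward_solution:
  fixes a b :: "nat \<Rightarrow> real"
  assumes a_pos: "\<And>n. a n > 0" and b_pos: "\<And>n. b n > 0"
  obtains d where "\<And>n. d n > 0" "\<And>n. d n = a n * d (Suc n) + b n * d (Suc (Suc n))"
proof -
  let ?sol = "solution_from_slope a b"
  have b_nonzero: "b n \<noteq> 0" for n using b_pos[of n] by simp
  have "\<exists>t. 0 \<le> t \<and> t \<le> 1 / a 0 \<and> (\<forall>n\<le>N. ?sol t n \<ge> 0)" for N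
  proof -
    obtain d where "\<forall>n. d n > 0" "\<forall>n<Suc N. d n = a n * d (Suc n) + b n * d (Suc (Suc n))"
      using positive_truncated_solution[of a b "Suc N", OF a_pos b_pos] by blast
    hence d_pos: "d n > 0"
      and d_recursion: "n < Suc N \<Longrightarrow> d n = a n * d (Suc n) + b n * d (Suc (Suc n))" for n
      by simp_all
    have "a 0 * d 1 \<le> d 0"
      using d_recursion[of 0] b_pos[of 0] d_pos[of 2] by (simp add: numeral_2_eq_2)
    hence "d 1 / d 0 \<le> 1 / a 0" using d_pos[of 0] a_pos[of 0] by (simp add: field_simps)
    moreover have "?sol (d 1 / d 0) n \<ge> 0" if "n \<le> N" for n
      using solution_from_slope_unique[of b d "Suc N" a n, OF b_nonzero _ d_recursion] d_pos that
      by (simp add: less_imp_neq[symmetric] less_imp_le)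
    ultimately show ?thesis using d_pos by (intro exI[of _ "d 1 / d 0"]) (auto simp: less_imp_le)
  qed
  then obtain t where slope: "\<And>N. t N \<in> {0..1 / a 0}" "\<And>N n. n \<le> N \<Longrightarrow> ?sol (t N) n \<ge> 0"
    unfolding atLeastAtMost_iff by metis
  obtain l \<phi> where subseq: "strict_mono \<phi>" "(t \<circ> \<phi>) \<longlonglongrightarrow> l"
    using compact_imp_seq_compact[OF compact_Icc, THEN seq_compactE, of t 0 "1 / a 0"] slope(1)
    by blast
  have sol_nonneg: "?sol l n \<ge> 0" for n
  proof (rule LIMSEQ_le_const)
    show "(\<lambda>N. ?sol (t (\<phi> N)) n) \<longlonglongrightarrow> ?sol l n"
      using continuous_solution_from_slope[of b a n, OF b_nonzero] subseq(2)
      by (auto simp: o_def continuous_on_eq_continuous_at intro: isCont_tendsto_compose)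
    show "\<exists>M. \<forall>N\<ge>M. 0 \<le> ?sol (t (\<phi> N)) n"
      using slope(2) seq_suble[OF subseq(1)] by (meson le_trans)
  qed
  have recursion: "?sol l n = a n * ?sol l (Suc n) + b n * ?sol l (Suc (Suc n))" for n
    using b_nonzero[of n] by simp
  show ?thesis
  proof (rule that)
    show "?sol l n > 0" for n
      by (rule nonneg_solution_pos[of a b, OF a_pos b_pos sol_nonneg _ recursion]) simp
  qed (rule recursion)
qed

fun forward_solution :: "(nat \<Rightarrow> real) \<Rightarrow> (nat \<Rightarrow> real) \<Rightarrow> nat \<Rightarrow> real" where
  "forward_solution a b 0 = 1"
| "forward_solution a b (Suc 0) = 1"
| "forward_solution a b (Suc (Suc n)) =
    a (Suc (Suc n)) * forward_solution a b (Suc n) + b (Suc (Suc n)) * forward_solution a b n"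

locale step_probabilities =
  fixes q p1 p2 :: "nat \<Rightarrow> real"
  assumes probs: "\<And>k. k \<ge> 2 \<Longrightarrow> q k > 0 \<and> p1 k \<ge> 0 \<and> p2 k > 0 \<and> q k + p1 k + p2 k = 1"
begin

lemma q_pos: "k \<ge> 2 \<Longrightarrow> q k > 0"
  and p1_nonneg: "k \<ge> 2 \<Longrightarrow> p1 k \<ge> 0"
  and p2_pos: "k \<ge> 2 \<Longrightarrow> p2 k > 0"
  and probs_sum: "k \<ge> 2 \<Longrightarrow> q k + p1 k + p2 k = 1"
  using probs by simp_all

definition coeff_a :: "nat \<Rightarrow> real" where
  "coeff_a k = (p1 k + p2 k) / q k"

definition coeff_b :: "nat \<Rightarrow> real" where
  "coeff_b k = p2 k / q k"

lemma coeff_a_pos: "k \<ge> 2 \<Longrightarrow> coeff_a k > 0"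
  and coeff_b_pos: "k \<ge> 2 \<Longrightarrow> coeff_b k > 0"
  and coeff_b_le_coeff_a: "k \<ge> 2 \<Longrightarrow> coeff_b k \<le> coeff_a k"
  using q_pos[of k] p1_nonneg[of k] p2_pos[of k]
  by (simp_all add: coeff_a_def coeff_b_def add_nonneg_pos divide_right_mono)

lemma
  assumes "k \<ge> 2"
  shows rho_walk_pos: "rho_walk q p1 p2 k > 0"
    and rho_walk_fixed_point: "rho_walk q p1 p2 k = coeff_a k + coeff_b k / rho_walk q p1 p2 k"
proof -
  define s where "s = sqrt ((coeff_a k)\<^sup>2 + 4 * coeff_b k)"
  have s: "s \<ge> 0" "s * s = coeff_a k * coeff_a k + 4 * coeff_b k"
    using coeff_b_pos[OF assms] by (auto simp: s_def power2_eq_square)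
  have rho: "rho_walk q p1 p2 k = (coeff_a k + s) / 2"
    by (simp add: rho_walk_def Let_def coeff_a_def coeff_b_def s_def)
  show "rho_walk q p1 p2 k > 0" using coeff_a_pos[OF assms] s(1) rho by simp
  have "(coeff_a k + s) / 2 * ((coeff_a k + s) / 2) = coeff_a k * ((coeff_a k + s) / 2) + coeff_b k"
    using s(2) by (simp add: field_simps)
  thus "rho_walk q p1 p2 k = coeff_a k + coeff_b k / rho_walk q p1 p2 k"
    using coeff_a_pos[OF assms] s(1) unfolding rho by (simp add: field_simps)
qed

text \<open>For \<open>k \<ge> 2\<close>, the function \<open>\<lambda>k. \<Sum>j\<ge>k. u j\<close> is harmonic for \<open>X\<close>, respectively \<open>Y\<close>, at \<open>k\<close>.\<close>

definition harmonic_increments :: "bool \<Rightarrow> (nat \<Rightarrow> real) \<Rightarrow> bool" where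
  "harmonic_increments isX u \<longleftrightarrow>
    (\<forall>k\<ge>2. if isX then u k = coeff_a k * u (k - 1) + coeff_b k * u (k - 2)
           else u (k - 1) = coeff_a k * u k + coeff_b k * u (k + 1))"

lemma obtain_harmonic_increments:
  obtains u where "\<And>n. u n > 0" "harmonic_increments isX u"
proof (cases isX)
  case True
  let ?u = "forward_solution coeff_a coeff_b"
  have "?u n > 0" for n
    by (induction n rule: induct_nat_012) (simp_all add: add_pos_pos coeff_a_pos coeff_b_pos)
  moreover have "harmonic_increments isX ?u"
    using True
    by (auto simp: harmonic_increments_def numeral_2_eq_2 Suc_le_eq dest!: less_imp_Suc_add)
  ultimately show ?thesis by (rule that)
next
  case False
  obtain d where d_pos: "\<And>n. d n > 0"
    and recursion: "\<And>n. d n = coeff_a (n + 2) * d (Suc n) + coeff_b (n + 2) * d (Suc (Suc n))"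
    using positive_backward_solution[of "\<lambda>n. coeff_a (n + 2)" "\<lambda>n. coeff_b (n + 2)"]
      coeff_a_pos coeff_b_pos by (metis le_add2)
  have "d (k - 2) = coeff_a k * d (k - 1) + coeff_b k * d k" if "k \<ge> 2" for k
    using recursion[of "k - 2"] that by (simp add: Suc_diff_le numeral_2_eq_2 Suc_diff_Suc)
  hence "harmonic_increments isX (\<lambda>n. d (n - 1))"
    using False by (simp add: harmonic_increments_def numeral_2_eq_2)
  with d_pos show ?thesis by (intro that)
qed

end

locale critical_walk = step_probabilities +
  fixes isX :: bool and \<beta> :: real
  assumes coeff_a_convergent: "\<exists>a>0. (\<lambda>k. (p1 k + p2 k) / q k) \<longlonglongrightarrow> a"
    and coeff_b_convergent: "\<exists>b>0. (\<lambda>k. p2 k / q k) \<longlonglongrightarrow> b"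
    and rho_asymptotics:
      "(\<lambda>k. rho_walk q p1 p2 k - (if isX then 1 - 3 * r_seq \<beta> k else 1 + 3 * r_seq \<beta> k))
      \<in> O(\<lambda>k. (r_seq \<beta> k)\<^sup>2)"
begin

sublocale pred: slowly_varying "r_seq \<beta>" "\<lambda>k. k - 1"
  by unfold_locales (rule r_seq_pos r_seq_tendsto_0 filterlim_minus_const_nat_at_top
      r_seq_pred_diff_bigo)+

sublocale succ: slowly_varying "r_seq \<beta>" Suc
  by unfold_locales (rule r_seq_pos r_seq_tendsto_0 filterlim_Suc r_seq_Suc_diff_bigo)+

lemma rho_walk_tendsto_1: "rho_walk q p1 p2 \<longlonglongrightarrow> 1"
proof (rule tendsto_1_of_linear_asymptotics[OF _ r_seq_tendsto_0])
  show "(\<lambda>n. rho_walk q p1 p2 n - (1 + (if isX then - 3 else 3) * r_seq \<beta> n))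
      \<in> O(\<lambda>n. (r_seq \<beta> n)\<^sup>2)"
    using rho_asymptotics by (cases isX) simp_all
qed

lemma coeff_limits:
  obtains a b where "coeff_a \<longlonglongrightarrow> a" "coeff_b \<longlonglongrightarrow> b" "0 < b" "b \<le> a" "a \<le> 1"
proof -
  obtain a b where a_lim: "coeff_a \<longlonglongrightarrow> a" and b_lim: "coeff_b \<longlonglongrightarrow> b" "b > 0"
    using coeff_a_convergent coeff_b_convergent
    by (auto simp: coeff_a_def[abs_def] coeff_b_def[abs_def])
  have "coeff_a k \<le> rho_walk q p1 p2 k" if "k \<ge> 2" for k
    using rho_walk_fixed_point[OF that] divide_pos_pos[OF coeff_b_pos[OF that]
      rho_walk_pos[OF that]] by linarith
  hence "a \<le> 1" by (intro LIMSEQ_le[OF a_lim rho_walk_tendsto_1]) auto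
  moreover have "b \<le> a" using coeff_b_le_coeff_a by (intro LIMSEQ_le[OF b_lim(1) a_lim]) auto
  ultimately show ?thesis using a_lim b_lim that by blast
qed

lemma q_p2_limits:
  obtains Q R where "Q > 0" "R > 0" "q \<longlonglongrightarrow> Q" "p2 \<longlonglongrightarrow> R"
proof -
  obtain a b where limits: "coeff_a \<longlonglongrightarrow> a" "coeff_b \<longlonglongrightarrow> b" "0 < b" "b \<le> a"
    by (rule coeff_limits)
  have "(\<lambda>k. 1 / (1 + coeff_a k)) \<longlonglongrightarrow> 1 / (1 + a)" "(\<lambda>k. coeff_b k / (1 + coeff_a k)) \<longlonglongrightarrow> b / (1 + a)"
    using limits by (auto intro!: tendsto_intros)
  moreover have "eventually (\<lambda>k. 1 / (1 + coeff_a k) = q k \<and>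
      coeff_b k / (1 + coeff_a k) = p2 k) sequentially"
    using eventually_ge_at_top[of 2]
  proof eventually_elim
    case (elim k)
    have "1 + coeff_a k = 1 / q k"
      using q_pos[OF elim] probs_sum[OF elim] by (simp add: coeff_a_def field_simps)
    thus ?case using q_pos[OF elim] by (simp add: coeff_b_def)
  qed
  ultimately have "q \<longlonglongrightarrow> 1 / (1 + a)" "p2 \<longlonglongrightarrow> b / (1 + a)"
    by (auto elim: Lim_transform_eventually eventually_mono)
  with limits show ?thesis by (intro that) auto
qed

lemma increment_ratio_asymptotics:
  assumes u_pos: "\<And>n. u n > 0" and "harmonic_increments isX u"
  shows "(\<lambda>n. u n / u (n - 1) - (1 - 3 * r_seq \<beta> n)) \<in> O(\<lambda>n. (r_seq \<beta> n)\<^sup>2)"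
proof -
  obtain a b where limits: "coeff_a \<longlonglongrightarrow> a" "coeff_b \<longlonglongrightarrow> b" "0 < b" "b \<le> a" "a \<le> 1"
    by (rule coeff_limits)
  have rho_fixed: "eventually (\<lambda>n. rho_walk q p1 p2 n =
      coeff_a n + coeff_b n / rho_walk q p1 p2 n) sequentially"
    using eventually_ge_at_top[of 2] by (rule eventually_mono) (rule rho_walk_fixed_point)
  show ?thesis
  proof (cases isX)
    case True
    have "eventually (\<lambda>n. u n / u (n - 1) =
        coeff_a n + coeff_b n / (u (n - 1) / u (n - 1 - 1))) sequentially"
      using eventually_ge_at_top[of 2]
    proof eventually_elim
      case (elim n)
      hence "u n = coeff_a n * u (n - 1) + coeff_b n * u (n - 2)"
        using assms(2) True by (simp add: harmonic_increments_def)
      thus ?case using u_pos[of "n - 1"] by (simp add: field_simps numeral_2_eq_2)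
    qed
    from pred.continued_fraction_asymptotics[OF limits _ this rho_fixed, of "- 3"]
    show ?thesis using u_pos rho_asymptotics True by simp
  next
    case False
    have "eventually (\<lambda>n. u (n - 1) / u n =
        coeff_a n + coeff_b n / (u (Suc n - 1) / u (Suc n))) sequentially"
      using eventually_ge_at_top[of 2]
    proof eventually_elim
      case (elim n)
      hence "u (n - 1) = coeff_a n * u n + coeff_b n * u (n + 1)"
        using assms(2) False by (simp add: harmonic_increments_def)
      thus ?case using u_pos[of n] by (simp add: field_simps)
    qed
    from succ.continued_fraction_asymptotics[OF limits _ this rho_fixed, of 3]
    have "(\<lambda>n. u (n - 1) / u n - (1 + 3 * r_seq \<beta> n)) \<in> O(\<lambda>n. (r_seq \<beta> n)\<^sup>2)"
      using u_pos rho_asymptotics False by simp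
    from inverse_asymptotics[OF this r_seq_tendsto_0] show ?thesis by simp
  qed
qed

end

section \<open>Markov chains with bounded upward jumps\<close>

definition determined_upto :: "nat \<Rightarrow> ((nat \<Rightarrow> nat) \<Rightarrow> bool) \<Rightarrow> bool" where
  "determined_upto n \<Phi> \<longleftrightarrow> (\<forall>p p'. (\<forall>i\<le>n. p i = p' i) \<longrightarrow> \<Phi> p = \<Phi> p')"

primrec follows :: "nat \<Rightarrow> nat list \<Rightarrow> (nat \<Rightarrow> nat) \<Rightarrow> bool" where
  "follows n [] p \<longleftrightarrow> True"
| "follows n (y # ys) p \<longleftrightarrow> p (Suc n) = y \<and> follows (Suc n) ys p"

lemma determined_upto_follows:
  assumes "determined_upto n \<Phi>"
  shows "determined_upto (n + length ys) (\<lambda>p. \<Phi> p \<and> follows n ys p)"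
proof -
  have "follows n ys p = follows n ys p'" if "\<forall>i\<le>n + length ys. p i = p' i" for n ys p p'
    using that by (induction ys arbitrary: n) auto
  thus ?thesis using assms unfolding determined_upto_def by (metis trans_le_add1)
qed

locale nat_chain =
  fixes M :: "'a measure" and Z :: "nat \<Rightarrow> 'a \<Rightarrow> nat" and x0 :: nat and P :: "nat \<Rightarrow> nat \<Rightarrow> real"
    and d :: nat
  assumes chain: "is_markov_chain M Z x0 P"
    and P_nonneg: "\<And>x y. P x y \<ge> 0"
    and P_sum: "\<And>x. (\<Sum>y\<le>x+d. P x y) = 1"
    and P_zero: "\<And>x y. y > x + d \<Longrightarrow> P x y = 0"

sublocale nat_chain \<subseteq> prob_space M
  using chain by (simp add: is_markov_chain_def)

context nat_chain
begin

lemma measurable_Z [measurable]: "Z n \<in> M \<rightarrow>\<^sub>M count_space UNIV"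
  using chain by (simp add: is_markov_chain_def)

definition cylinder :: "nat list \<Rightarrow> 'a set" where
  "cylinder xs = {\<omega> \<in> space M. \<forall>i<length xs. Z i \<omega> = xs ! i}"

lemma cylinder_sets [measurable]: "cylinder xs \<in> events"
  unfolding cylinder_def by measurable

lemma prob_cylinder_Suc:
  assumes "length xs = Suc n"
  shows "prob (cylinder xs \<inter> {\<omega> \<in> space M. Z (Suc n) \<omega> = y}) = prob (cylinder xs) * P (xs ! n) y"
proof -
  define z where "z i = (if i \<le> n then xs ! i else y)" for i
  have "cylinder xs \<inter> {\<omega> \<in> space M. Z (Suc n) \<omega> = y} = {\<omega> \<in> space M. \<forall>i\<le>Suc n. Z i \<omega> = z i}"
    using assms by (auto simp: cylinder_def z_def le_Suc_eq less_Suc_eq_le)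
  moreover have "cylinder xs = {\<omega> \<in> space M. \<forall>i\<le>n. Z i \<omega> = z i}"
    using assms by (auto simp: cylinder_def z_def less_Suc_eq_le)
  moreover have "z n = xs ! n" "z (Suc n) = y" by (simp_all add: z_def)
  ultimately show ?thesis using chain by (simp add: is_markov_chain_def)
qed

definition path_event :: "((nat \<Rightarrow> nat) \<Rightarrow> bool) \<Rightarrow> 'a set" where
  "path_event \<Phi> = {\<omega> \<in> space M. \<Phi> (\<lambda>i. Z i \<omega>)}"

definition step_mean :: "(nat \<Rightarrow> real) \<Rightarrow> nat \<Rightarrow> real" where
  "step_mean f x = (\<Sum>y\<le>x+d. P x y * f y)"

subsection \<open>Path events and the Markov property\<close>

lemma path_event_True [simp]: "path_event (\<lambda>p. True) = space M"
  by (simp add: path_event_def)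

lemma determined_path_event_eq_UN:
  assumes "determined_upto n \<Phi>"
  shows "path_event \<Phi> = (\<Union>xs\<in>{xs. length xs = Suc n \<and> \<Phi> (nth xs)}. cylinder xs)"
proof safe
  fix \<omega> assume \<omega>: "\<omega> \<in> path_event \<Phi>"
  define xs where "xs = map (\<lambda>i. Z i \<omega>) [0..<Suc n]"
  have path_xs: "length xs = Suc n" "\<forall>i\<le>n. Z i \<omega> = xs ! i"
    by (auto simp: xs_def simp del: upt_Suc)
  hence "\<Phi> (nth xs)" using assms \<omega> unfolding determined_upto_def path_event_def
    by (metis (no_types, lifting) mem_Collect_eq)
  with path_xs \<omega> show "\<omega> \<in> (\<Union>xs\<in>{xs. length xs = Suc n \<and> \<Phi> (nth xs)}. cylinder xs)"
    by (auto simp: path_event_def cylinder_def less_Suc_eq_le)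
next
  fix \<omega> xs assume "length xs = Suc n" "\<Phi> (nth xs)" "\<omega> \<in> cylinder xs"
  moreover from this have "\<Phi> (\<lambda>i. Z i \<omega>) = \<Phi> (nth xs)"
    using assms[unfolded determined_upto_def, rule_format, of "\<lambda>i. Z i \<omega>" "nth xs"]
    by (simp add: cylinder_def)
  ultimately show "\<omega> \<in> path_event \<Phi>" by (simp add: path_event_def cylinder_def)
qed

lemma determined_path_event_sets:
  assumes "determined_upto n \<Phi>"
  shows "path_event \<Phi> \<in> events"
  unfolding determined_path_event_eq_UN[OF assms] by (rule sets.countable_UN') auto

lemma path_event_conj_sets:
  assumes [measurable]: "path_event \<Phi> \<in> events"
  shows "path_event (\<lambda>p. \<Phi> p \<and> Q (p n)) \<in> events"
proof -
  have "path_event (\<lambda>p. \<Phi> p \<and> Q (p n)) = path_event \<Phi> \<inter> {\<omega> \<in> space M. Q (Z n \<omega>)}"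
    by (auto simp: path_event_def)
  also have "\<dots> \<in> events" by measurable
  finally show ?thesis .
qed

lemma path_event_Ex_sets:
  fixes \<Phi> :: "nat \<Rightarrow> (nat \<Rightarrow> nat) \<Rightarrow> bool"
  assumes "\<And>n. path_event (\<Phi> n) \<in> events"
  shows "path_event (\<lambda>p. \<exists>n. \<Phi> n p) \<in> events"
proof -
  have "path_event (\<lambda>p. \<exists>n. \<Phi> n p) = (\<Union>n. path_event (\<Phi> n))" by (auto simp: path_event_def)
  thus ?thesis using assms by (auto intro: sets.countable_UN)
qed

lemma sums_prob_path_event_Ex:
  fixes \<Phi> :: "nat \<Rightarrow> (nat \<Rightarrow> nat) \<Rightarrow> bool"
  assumes "\<And>n. path_event (\<Phi> n) \<in> events" "\<And>n m p. \<Phi> n p \<Longrightarrow> \<Phi> m p \<Longrightarrow> n = m"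
  shows "(\<lambda>n. prob (path_event (\<Phi> n))) sums prob (path_event (\<lambda>p. \<exists>n. \<Phi> n p))"
proof -
  have "path_event (\<lambda>p. \<exists>n. \<Phi> n p) = (\<Union>n. path_event (\<Phi> n))" by (auto simp: path_event_def)
  moreover have "disjoint_family (\<lambda>n. path_event (\<Phi> n))"
    using assms(2) by (auto simp: disjoint_family_on_def path_event_def)
  ultimately show ?thesis using assms(1) by (auto intro!: finite_measure_UNION)
qed

lemma markov_property:
  assumes "determined_upto n \<Phi>"
  shows "prob (path_event (\<lambda>p. \<Phi> p \<and> p n = x \<and> p (Suc n) = y)) =
    prob (path_event (\<lambda>p. \<Phi> p \<and> p n = x)) * P x y"
proof -
  define I where "I = {xs. length xs = Suc n \<and> \<Phi> (nth xs) \<and> xs ! n = x}"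
  let ?Y = "{\<omega> \<in> space M. Z (Suc n) \<omega> = y}"
  have countable_I: "countable I" by (auto intro: countable_subset[OF subset_UNIV])
  have disjoint: "disjoint_family_on cylinder I"
    unfolding disjoint_family_on_def
  proof safe
    fix xs ys \<omega> assume "xs \<in> I" "ys \<in> I" "xs \<noteq> ys" "\<omega> \<in> cylinder xs" "\<omega> \<in> cylinder ys"
    hence "xs = ys" by (intro nth_equalityI) (auto simp: cylinder_def I_def)
    with \<open>xs \<noteq> ys\<close> show "\<omega> \<in> {}" by simp
  qed
  have "determined_upto n (\<lambda>p. \<Phi> p \<and> p n = x)" using assms by (auto simp: determined_upto_def)
  from determined_path_event_eq_UN[OF this]
  have present: "path_event (\<lambda>p. \<Phi> p \<and> p n = x) = (\<Union>xs\<in>I. cylinder xs)"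
    unfolding I_def by simp
  hence future: "path_event (\<lambda>p. \<Phi> p \<and> p n = x \<and> p (Suc n) = y) = (\<Union>xs\<in>I. cylinder xs \<inter> ?Y)"
    by (auto simp: path_event_def set_eq_iff)
  have "emeasure M (\<Union>xs\<in>I. cylinder xs \<inter> ?Y) =
      (\<integral>\<^sup>+xs. emeasure M (cylinder xs \<inter> ?Y) \<partial>count_space I)"
    using disjoint countable_I by (intro emeasure_UN_countable) (auto simp: disjoint_family_on_def)
  also have "\<dots> = (\<integral>\<^sup>+xs. emeasure M (cylinder xs) * ennreal (P x y) \<partial>count_space I)"
    by (intro nn_integral_cong)
      (auto simp: I_def emeasure_eq_measure prob_cylinder_Suc ennreal_mult' P_nonneg)
  also have "\<dots> = (\<integral>\<^sup>+xs. emeasure M (cylinder xs) \<partial>count_space I) * ennreal (P x y)"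
    by (rule nn_integral_multc) simp
  also have "(\<integral>\<^sup>+xs. emeasure M (cylinder xs) \<partial>count_space I) = emeasure M (\<Union>xs\<in>I. cylinder xs)"
    using disjoint countable_I by (intro emeasure_UN_countable[symmetric]) auto
  finally show ?thesis
    unfolding present future by (simp add: emeasure_eq_measure P_nonneg flip: ennreal_mult')
qed

lemma AE_start: "AE \<omega> in M. Z 0 \<omega> = x0"
proof -
  have "prob {\<omega> \<in> space M. \<forall>i\<le>n. Z i \<omega> = z i} =
      (if z 0 = x0 then 1 else 0) * (\<Prod>i<n. P (z i) (z (i + 1)))" for n z
    using chain unfolding is_markov_chain_def by blast
  from this[of 0 "\<lambda>_. x0"] have "prob {\<omega> \<in> space M. Z 0 \<omega> = x0} = 1" by simp
  thus ?thesis by (subst (asm) prob_eq_1) simp_all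
qed

lemma AE_step: "AE \<omega> in M. \<forall>i. P (Z i \<omega>) (Z (Suc i) \<omega>) \<noteq> 0"
proof -
  have "AE \<omega> in M. \<forall>i x y. P x y = 0 \<longrightarrow> \<not> (Z i \<omega> = x \<and> Z (Suc i) \<omega> = y)"
    unfolding AE_all_countable
  proof (intro allI)
    fix i x y
    show "AE \<omega> in M. P x y = 0 \<longrightarrow> \<not> (Z i \<omega> = x \<and> Z (Suc i) \<omega> = y)"
    proof (cases "P x y = 0")
      case True
      have "prob (path_event (\<lambda>p. True \<and> p i = x \<and> p (Suc i) = y)) = 0"
        by (subst markov_property) (auto simp: determined_upto_def True)
      hence "prob {\<omega> \<in> space M. Z i \<omega> = x \<and> Z (Suc i) \<omega> = y} = 0" by (simp add: path_event_def)
      thus ?thesis by (subst (asm) prob_eq_0) (auto elim: eventually_mono)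
    qed simp
  qed
  thus ?thesis by eventually_elim blast
qed

lemma AE_le: "AE \<omega> in M. \<forall>n. Z n \<omega> \<le> x0 + d * n"
  using AE_start AE_step
proof eventually_elim
  case (elim \<omega>)
  show ?case
  proof
    fix n show "Z n \<omega> \<le> x0 + d * n"
    proof (induction n)
      case (Suc n)
      have "Z (Suc n) \<omega> \<le> Z n \<omega> + d" using elim(2) P_zero by (meson not_le)
      with Suc show ?case by simp
    qed (use elim in simp)
  qed
qed

lemma set_integrable_path_event:
  fixes f :: "nat \<Rightarrow> real"
  assumes [measurable]: "path_event \<Phi> \<in> events"
  shows "set_integrable M (path_event \<Phi>) (\<lambda>\<omega>. f (Z n \<omega>))"
  unfolding set_integrable_def
proof (rule integrable_const_bound)
  show "AE \<omega> in M. norm (indicator (path_event \<Phi>) \<omega> *\<^sub>R f (Z n \<omega>)) \<le> (\<Sum>x\<le>x0 + d * n. \<bar>f x\<bar>)"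
    using AE_le
  proof eventually_elim
    case (elim \<omega>)
    have "\<bar>f (Z n \<omega>)\<bar> \<le> (\<Sum>x\<le>x0 + d * n. \<bar>f x\<bar>)" using elim by (intro member_le_sum) auto
    thus ?case by (auto simp: indicator_def intro: order_trans[OF abs_ge_zero])
  qed
qed measurable

lemma integrable_Z: "integrable M (\<lambda>\<omega>. f (Z n \<omega>))" for f :: "nat \<Rightarrow> real"
  using set_integrable_path_event[of "\<lambda>_. True" f n]
  by (simp add: set_integrable_def cong: Bochner_Integration.integrable_cong)

lemma set_integral_path_event:
  fixes f :: "nat \<Rightarrow> real"
  assumes [measurable]: "path_event \<Phi> \<in> events"
  shows "(LINT \<omega>:path_event \<Phi>|M. f (Z n \<omega>)) =
    (\<Sum>x\<le>x0+d*n. f x * prob (path_event (\<lambda>p. \<Phi> p \<and> p n = x)))"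
proof -
  have [measurable]: "path_event (\<lambda>p. \<Phi> p \<and> p n = x) \<in> events" for x
    using path_event_conj_sets[OF assms, of "\<lambda>y. y = x" n] .
  have "(LINT \<omega>:path_event \<Phi>|M. f (Z n \<omega>)) =
      expectation (\<lambda>\<omega>. \<Sum>x\<le>x0+d*n. f x * indicator (path_event (\<lambda>p. \<Phi> p \<and> p n = x)) \<omega>)"
    unfolding set_lebesgue_integral_def
  proof (rule integral_cong_AE)
    show "AE \<omega> in M. indicator (path_event \<Phi>) \<omega> *\<^sub>R f (Z n \<omega>) =
        (\<Sum>x\<le>x0+d*n. f x * indicator (path_event (\<lambda>p. \<Phi> p \<and> p n = x)) \<omega>)"
      using AE_le AE_space
    proof eventually_elim
      case (elim \<omega>)
      have "(\<Sum>x\<le>x0+d*n. f x * indicator (path_event (\<lambda>p. \<Phi> p \<and> p n = x)) \<omega>) =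
          (\<Sum>x\<le>x0+d*n. if x = Z n \<omega> then f x * indicator (path_event \<Phi>) \<omega> else 0)"
        by (intro sum.cong) (auto simp: path_event_def indicator_def)
      thus ?case using elim by simp
    qed
  qed measurable
  also have "\<dots> = (\<Sum>x\<le>x0+d*n. f x * prob (path_event (\<lambda>p. \<Phi> p \<and> p n = x)))"
    by (subst Bochner_Integration.integral_sum) (auto simp: emeasure_eq_measure)
  finally show ?thesis .
qed

lemma prob_path_event:
  assumes "path_event \<Phi> \<in> events"
  shows "prob (path_event \<Phi>) = (\<Sum>x\<le>x0+d*n. prob (path_event (\<lambda>p. \<Phi> p \<and> p n = x)))"
  using set_integral_path_event[OF assms, of "\<lambda>_. 1" n] assms
  by (simp add: set_lebesgue_integral_def)

lemma set_integral_markov: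
  fixes f :: "nat \<Rightarrow> real"
  assumes "determined_upto n \<Phi>"
  shows "(LINT \<omega>:path_event \<Phi>|M. f (Z (Suc n) \<omega>)) = (LINT \<omega>:path_event \<Phi>|M. step_mean f (Z n \<omega>))"
proof -
  let ?w = "\<lambda>x. prob (path_event (\<lambda>p. \<Phi> p \<and> p n = x))"
  have sets: "path_event \<Phi> \<in> events" by (rule determined_path_event_sets) fact
  have prob_next: "prob (path_event (\<lambda>p. \<Phi> p \<and> p (Suc n) = y)) = (\<Sum>x\<le>x0+d*n. ?w x * P x y)" for y
  proof -
    have "prob (path_event (\<lambda>p. \<Phi> p \<and> p (Suc n) = y)) =
        (\<Sum>x\<le>x0+d*n. prob (path_event (\<lambda>p. (\<Phi> p \<and> p (Suc n) = y) \<and> p n = x)))"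
      using path_event_conj_sets[OF sets, of "\<lambda>z. z = y" "Suc n"] by (rule prob_path_event)
    also have "\<dots> = (\<Sum>x\<le>x0+d*n. ?w x * P x y)"
      by (simp add: markov_property[OF assms, symmetric] conj_ac)
    finally show ?thesis .
  qed
  have step_mean_eq: "(\<Sum>y\<le>x0+d*Suc n. P x y * f y) = step_mean f x" if "x \<le> x0 + d * n" for x
    unfolding step_mean_def using that by (intro sum.mono_neutral_right) (auto simp: P_zero)
  have "(LINT \<omega>:path_event \<Phi>|M. f (Z (Suc n) \<omega>)) =
      (\<Sum>y\<le>x0+d*Suc n. \<Sum>x\<le>x0+d*n. ?w x * (P x y * f y))"
    unfolding set_integral_path_event[OF sets] prob_next by (simp add: sum_distrib_left mult_ac)
  also have "\<dots> = (\<Sum>x\<le>x0+d*n. ?w x * (\<Sum>y\<le>x0+d*Suc n. P x y * f y))"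
    by (subst sum.swap) (simp only: sum_distrib_left)
  also have "\<dots> = (\<Sum>x\<le>x0+d*n. step_mean f x * ?w x)"
    by (intro sum.cong)
      (simp_all add: step_mean_eq mult.commute[of "?w _"] del: sum.atMost_Suc mult_Suc_right)
  also have "\<dots> = (LINT \<omega>:path_event \<Phi>|M. step_mean f (Z n \<omega>))"
    by (simp add: set_integral_path_event[OF sets])
  finally show ?thesis .
qed

subsection \<open>Transience\<close>

lemma expectation_Suc:
  "expectation (\<lambda>\<omega>. f (Z (Suc n) \<omega>)) = expectation (\<lambda>\<omega>. step_mean f (Z n \<omega>))"
  using set_integral_markov[of n "\<lambda>_. True" f]
  by (simp add: determined_upto_def set_integral_space integrable_Z)

lemma step_mean_sqrt_less:
  assumes h_pos: "\<And>x. h x > 0" and super: "step_mean h x \<le> h x" and step: "P x y > 0" "h y \<noteq> h x"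
  shows "step_mean (\<lambda>x. sqrt (h x)) x < sqrt (h x)"
proof -
  define s where "s = sqrt (h x)"
  have s_square: "s > 0" "s * s = h x" using h_pos[of x] by (auto simp: s_def)
  have y_le: "y \<le> x + d" using step(1) P_zero[of x y] by (cases "y > x + d") auto
  have square: "2 * s * sqrt (h y) = h y + h x - (sqrt (h y) - s)\<^sup>2" for y
    using s_square(2) h_pos[of y] by (simp add: power2_eq_square algebra_simps)
  have "2 * s * step_mean (\<lambda>x. sqrt (h x)) x = (\<Sum>y\<le>x+d. P x y * (2 * s * sqrt (h y)))"
    unfolding step_mean_def sum_distrib_left by (simp only: mult.left_commute)
  also have "\<dots> = step_mean h x + h x * (\<Sum>y\<le>x+d. P x y) - (\<Sum>y\<le>x+d. P x y * (sqrt (h y) - s)\<^sup>2)"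
    unfolding square
    by (simp add: step_mean_def sum.distrib sum_subtractf sum_distrib_left algebra_simps)
  also have "\<dots> < step_mean h x + h x * (\<Sum>y\<le>x+d. P x y)"
  proof -
    have "sqrt (h y) \<noteq> s" using step(2) by (simp add: s_def)
    hence "0 < P x y * (sqrt (h y) - s)\<^sup>2" using step by simp
    also have "\<dots> \<le> (\<Sum>y\<le>x+d. P x y * (sqrt (h y) - s)\<^sup>2)"
      using y_le by (intro member_le_sum) (auto simp: P_nonneg)
    finally show ?thesis by simp
  qed
  also have "\<dots> \<le> 2 * s * s" using super s_square P_sum[of x] by simp
  finally have "step_mean (\<lambda>x. sqrt (h x)) x < s"
    using s_square(1) by (subst (asm) mult_less_cancel_left_pos) auto
  thus ?thesis by (simp add: s_def)
qed

lemma expectation_decrease: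
  assumes decrease: "\<And>x. x \<le> K \<Longrightarrow> step_mean \<phi> x + \<delta> \<le> \<phi> x" and super: "\<And>x. step_mean \<phi> x \<le> \<phi> x"
  shows "expectation (\<lambda>\<omega>. \<phi> (Z (Suc n) \<omega>)) + \<delta> * prob {\<omega> \<in> space M. Z n \<omega> \<le> K} \<le>
      expectation (\<lambda>\<omega>. \<phi> (Z n \<omega>))"
proof -
  have "expectation (\<lambda>\<omega>. of_bool (Z n \<omega> \<le> K) :: real) =
      expectation (indicator {\<omega> \<in> space M. Z n \<omega> \<le> K})"
    by (intro Bochner_Integration.integral_cong) auto
  hence "prob {\<omega> \<in> space M. Z n \<omega> \<le> K} = expectation (\<lambda>\<omega>. of_bool (Z n \<omega> \<le> K))" by simp
  hence "expectation (\<lambda>\<omega>. \<phi> (Z (Suc n) \<omega>)) + \<delta> * prob {\<omega> \<in> space M. Z n \<omega> \<le> K} =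
      expectation (\<lambda>\<omega>. step_mean \<phi> (Z n \<omega>) + \<delta> * of_bool (Z n \<omega> \<le> K))"
    using integrable_Z[of "step_mean \<phi>" n] integrable_Z[of "\<lambda>x. of_bool (x \<le> K)" n]
    by (simp add: expectation_Suc)
  also have "\<dots> \<le> expectation (\<lambda>\<omega>. \<phi> (Z n \<omega>))"
  proof (rule integral_mono)
    show "step_mean \<phi> (Z n \<omega>) + \<delta> * of_bool (Z n \<omega> \<le> K) \<le> \<phi> (Z n \<omega>)" for \<omega>
      using decrease[of "Z n \<omega>"] super[of "Z n \<omega>"] by auto
  qed (use integrable_Z[of "\<lambda>x. step_mean \<phi> x + \<delta> * of_bool (x \<le> K)" n]
      in \<open>simp_all add: integrable_Z\<close>)
  finally show ?thesis .
qed

lemma summable_prob_Z_le: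
  assumes nonneg: "\<And>x. \<phi> x \<ge> 0" and super: "\<And>x. step_mean \<phi> x < \<phi> x"
  shows "summable (\<lambda>n. prob {\<omega> \<in> space M. Z n \<omega> \<le> K})"
proof (rule summableI_nonneg_bounded)
  fix N
  define \<delta> where "\<delta> = Min ((\<lambda>x. \<phi> x - step_mean \<phi> x) ` {..K})"
  have "\<delta> > 0" unfolding \<delta>_def using super by (subst Min_gr_iff) auto
  have "\<delta> \<le> \<phi> x - step_mean \<phi> x" if "x \<le> K" for x
    unfolding \<delta>_def using that by (intro Min_le) auto
  hence decrease: "step_mean \<phi> x + \<delta> \<le> \<phi> x" if "x \<le> K" for x
    using that by (simp add: le_diff_eq add.commute)
  have "expectation (\<lambda>\<omega>. \<phi> (Z N \<omega>)) + \<delta> * (\<Sum>n<N. prob {\<omega> \<in> space M. Z n \<omega> \<le> K}) \<le>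
      expectation (\<lambda>\<omega>. \<phi> (Z 0 \<omega>))"
  proof (induction N)
    case (Suc N)
    thus ?case using expectation_decrease[of K \<phi> \<delta> N, OF decrease less_imp_le[OF super]]
      by (simp add: ring_distribs)
  qed simp
  moreover have "expectation (\<lambda>\<omega>. \<phi> (Z N \<omega>)) \<ge> 0" by (simp add: nonneg)
  ultimately have "\<delta> * (\<Sum>n<N. prob {\<omega> \<in> space M. Z n \<omega> \<le> K}) \<le> expectation (\<lambda>\<omega>. \<phi> (Z 0 \<omega>))"
    by linarith
  thus "(\<Sum>n<N. prob {\<omega> \<in> space M. Z n \<omega> \<le> K}) \<le>
      expectation (\<lambda>\<omega>. \<phi> (Z 0 \<omega>)) / Min ((\<lambda>x. \<phi> x - step_mean \<phi> x) ` {..K})"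
    using \<open>\<delta> > 0\<close> unfolding \<delta>_def[symmetric] by (simp add: field_simps)
qed simp

lemma AE_at_top:
  assumes "\<And>x. \<phi> x \<ge> 0" "\<And>x. step_mean \<phi> x < \<phi> x"
  shows "AE \<omega> in M. filterlim (\<lambda>n. Z n \<omega>) at_top sequentially"
proof -
  have "AE \<omega> in M. eventually (\<lambda>n. \<omega> \<in> space M - {\<omega> \<in> space M. Z n \<omega> \<le> K}) sequentially" for K
    by (rule borel_cantelli_AE1) (auto simp: emeasure_eq_measure intro: summable_prob_Z_le assms)
  hence "AE \<omega> in M. \<forall>K. eventually (\<lambda>n. \<omega> \<in> space M - {\<omega> \<in> space M. Z n \<omega> \<le> K}) sequentially"
    by (simp add: AE_all_countable)
  thus ?thesis
  proof eventually_elim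
    case (elim \<omega>)
    show ?case unfolding filterlim_at_top
    proof
      fix K
      show "eventually (\<lambda>n. K \<le> Z n \<omega>) sequentially"
        using elim[rule_format, of K] by eventually_elim auto
    qed
  qed
qed

lemma expectation_tendsto_0:
  fixes h :: "nat \<Rightarrow> real"
  assumes transient: "AE \<omega> in M. filterlim (\<lambda>n. Z n \<omega>) at_top sequentially"
    and h_lim: "h \<longlonglongrightarrow> 0"
  shows "(\<lambda>n. expectation (\<lambda>\<omega>. h (Z n \<omega>))) \<longlonglongrightarrow> 0"
proof -
  have "Bseq h" using h_lim by (intro convergent_imp_Bseq convergentI)
  then obtain B where h_bounded: "\<And>x. norm (h x) \<le> B" by (elim BseqE) blast
  have "(\<lambda>n. expectation (\<lambda>\<omega>. h (Z n \<omega>))) \<longlonglongrightarrow> expectation (\<lambda>_. 0)"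
  proof (rule integral_dominated_convergence[where w = "\<lambda>_. B"])
    show "AE \<omega> in M. (\<lambda>n. h (Z n \<omega>)) \<longlonglongrightarrow> 0"
      using transient by eventually_elim (rule filterlim_compose[OF h_lim])
  qed (use h_bounded in auto)
  thus ?thesis by simp
qed

subsection \<open>Escape probabilities\<close>

context
  fixes h :: "nat \<Rightarrow> real" and k :: nat
  assumes h_nonneg: "\<And>x. h x \<ge> 0" and h_lim: "h \<longlonglongrightarrow> 0"
    and h_le: "h k \<le> h (k - 1)"
    and h_harmonic: "\<And>x. x > k \<Longrightarrow> step_mean h x = h x"
    and step_down: "\<And>x y. x > k \<Longrightarrow> P x y \<noteq> 0 \<Longrightarrow> k - 1 \<le> y"
    and transient: "AE \<omega> in M. filterlim (\<lambda>n. Z n \<omega>) at_top sequentially"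
begin

lemma survival_step_bounds:
  assumes det: "determined_upto n \<Phi>" and above: "\<And>p. \<Phi> p \<Longrightarrow> p n > k"
  defines "A \<equiv> path_event \<Phi>" and "A' \<equiv> path_event (\<lambda>p. \<Phi> p \<and> p (Suc n) > k)"
  defines "loss \<equiv> (LINT \<omega>:A|M. h (Z n \<omega>)) - (LINT \<omega>:A'|M. h (Z (Suc n) \<omega>))"
  shows "h k * (prob A - prob A') \<le> loss" "loss \<le> h (k - 1) * (prob A - prob A')"
proof -
  define B where "B = path_event (\<lambda>p. \<Phi> p \<and> p (Suc n) \<le> k)"
  have A_sets: "A \<in> events" unfolding A_def by (rule determined_path_event_sets) fact
  have [measurable]: "A' \<in> events" "B \<in> events"
    using path_event_conj_sets[OF A_sets[unfolded A_def], of "\<lambda>x. x > k" "Suc n"]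
      path_event_conj_sets[OF A_sets[unfolded A_def], of "\<lambda>x. x \<le> k" "Suc n"]
    by (simp_all add: A'_def B_def)
  have split: "A = A' \<union> B" "A' \<inter> B = {}" by (auto simp: A_def A'_def B_def path_event_def)
  have prob_B: "prob A - prob A' = prob B"
    unfolding split(1) by (subst finite_measure_Union) (auto simp: split(2))
  have integrable_A': "set_integrable M A' (\<lambda>\<omega>. h (Z (Suc n) \<omega>))"
    and integrable_B: "set_integrable M B (\<lambda>\<omega>. h (Z (Suc n) \<omega>))"
    using set_integrable_path_event \<open>A' \<in> events\<close> \<open>B \<in> events\<close> by (simp_all add: A'_def B_def)
  have "(LINT \<omega>:A|M. h (Z n \<omega>)) = (LINT \<omega>:A|M. step_mean h (Z n \<omega>))"
    using A_sets
    by (intro set_lebesgue_integral_cong) (auto simp: A_def path_event_def h_harmonic dest!: above)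
  also have "\<dots> = (LINT \<omega>:A|M. h (Z (Suc n) \<omega>))"
    unfolding A_def by (rule set_integral_markov[OF det, symmetric])
  also have "\<dots> = (LINT \<omega>:A'|M. h (Z (Suc n) \<omega>)) + (LINT \<omega>:B|M. h (Z (Suc n) \<omega>))"
    unfolding split(1) by (rule set_integral_Un[OF split(2) integrable_A' integrable_B])
  finally have loss_eq: "loss = (LINT \<omega>:B|M. h (Z (Suc n) \<omega>))" by (simp add: loss_def)
  have on_B: "AE \<omega>\<in>B in M. h k \<le> h (Z (Suc n) \<omega>) \<and> h (Z (Suc n) \<omega>) \<le> h (k - 1)"
    using AE_step
  proof eventually_elim
    case (elim \<omega>)
    show ?case
    proof
      assume "\<omega> \<in> B"
      hence "Z n \<omega> > k" "Z (Suc n) \<omega> \<le> k" using above by (auto simp: B_def path_event_def)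
      moreover from this have "k - 1 \<le> Z (Suc n) \<omega>" using step_down elim by blast
      ultimately have "Z (Suc n) \<omega> = k - 1 \<or> Z (Suc n) \<omega> = k" by linarith
      thus "h k \<le> h (Z (Suc n) \<omega>) \<and> h (Z (Suc n) \<omega>) \<le> h (k - 1)" using h_le by auto
    qed
  qed
  show "h k * (prob A - prob A') \<le> loss" "loss \<le> h (k - 1) * (prob A - prob A')"
    unfolding loss_eq prob_B by (rule set_integral_between[OF \<open>B \<in> events\<close> integrable_B on_B])+
qed

definition survives :: "((nat \<Rightarrow> nat) \<Rightarrow> bool) \<Rightarrow> nat \<Rightarrow> nat \<Rightarrow> (nat \<Rightarrow> nat) \<Rightarrow> bool" where
  "survives \<Phi> n m p \<longleftrightarrow> \<Phi> p \<and> (\<forall>j\<le>m. p (n + j) > k)"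

lemma survives_Suc: "survives \<Phi> n (Suc m) = (\<lambda>p. survives \<Phi> n m p \<and> p (Suc (n + m)) > k)"
  by (auto simp: survives_def fun_eq_iff le_Suc_eq)

lemma determined_upto_survives:
  assumes "determined_upto n \<Phi>"
  shows "determined_upto (n + m) (survives \<Phi> n m)"
  using assms
  unfolding determined_upto_def survives_def by (metis le_add1 order_trans add_left_mono)

lemma path_event_survives_sets:
  assumes "determined_upto n \<Phi>"
  shows "path_event (survives \<Phi> n m) \<in> events"
  using determined_path_event_sets[OF determined_upto_survives[OF assms]] .

lemma prob_survives_tendsto:
  assumes "determined_upto n \<Phi>"
  shows "path_event (\<lambda>p. \<Phi> p \<and> (\<forall>j\<ge>n. p j > k)) \<in> events"
    and "(\<lambda>m. prob (path_event (survives \<Phi> n m))) \<longlonglongrightarrow> prob (path_event (\<lambda>p. \<Phi> p \<and> (\<forall>j\<ge>n. p j > k)))"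
proof -
  note sets = path_event_survives_sets[OF assms]
  have escape_eq_INT: "path_event (\<lambda>p. \<Phi> p \<and> (\<forall>j\<ge>n. p j > k)) = (\<Inter>m. path_event (survives \<Phi> n m))"
    by (auto simp: path_event_def survives_def le_iff_add)
  show "path_event (\<lambda>p. \<Phi> p \<and> (\<forall>j\<ge>n. p j > k)) \<in> events"
    unfolding escape_eq_INT using sets by (intro sets.countable_INT) auto
  show "(\<lambda>m. prob (path_event (survives \<Phi> n m))) \<longlonglongrightarrow> prob (path_event (\<lambda>p. \<Phi> p \<and> (\<forall>j\<ge>n. p j > k)))"
    unfolding escape_eq_INT
  proof (rule finite_Lim_measure_decseq)
    show "decseq (\<lambda>m. path_event (survives \<Phi> n m))"
      by (intro decseq_SucI) (auto simp: survives_Suc path_event_def)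
  qed (use sets in auto)
qed

lemma set_integral_survives_tendsto_0:
  assumes "determined_upto n \<Phi>"
  shows "(\<lambda>m. LINT \<omega>:path_event (survives \<Phi> n m)|M. h (Z (n + m) \<omega>)) \<longlonglongrightarrow> 0"
proof (rule tendsto_sandwich[OF _ _ tendsto_const])
  show "(\<lambda>m. expectation (\<lambda>\<omega>. h (Z (n + m) \<omega>))) \<longlonglongrightarrow> 0"
    using LIMSEQ_ignore_initial_segment[OF expectation_tendsto_0[OF transient h_lim], of n]
    by (simp add: add.commute)
  have "0 \<le> (LINT \<omega>:path_event (survives \<Phi> n m)|M. h (Z (n + m) \<omega>))"
    "(LINT \<omega>:path_event (survives \<Phi> n m)|M. h (Z (n + m) \<omega>)) \<le> expectation (\<lambda>\<omega>. h (Z (n + m) \<omega>))"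
    for m
    unfolding set_lebesgue_integral_def
    using set_integrable_path_event[OF path_event_survives_sets[OF assms], of m h "n + m"]
    by (auto intro!: integral_nonneg_AE integral_mono simp: integrable_Z h_nonneg indicator_def
        set_integrable_def)
  thus "eventually (\<lambda>m. 0 \<le> (LINT \<omega>:path_event (survives \<Phi> n m)|M. h (Z (n + m) \<omega>))) sequentially"
    "eventually (\<lambda>m. (LINT \<omega>:path_event (survives \<Phi> n m)|M. h (Z (n + m) \<omega>)) \<le>
      expectation (\<lambda>\<omega>. h (Z (n + m) \<omega>))) sequentially"
    by simp_all
qed

lemma escape_prob_bounds:
  assumes det: "determined_upto n \<Phi>" and start: "\<And>p. \<Phi> p \<Longrightarrow> p n = k + 1"
  defines "E \<equiv> path_event (\<lambda>p. \<Phi> p \<and> (\<forall>j\<ge>n. p j > k))"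
  shows "(h k - h (k + 1)) * prob (path_event \<Phi>) \<le> h k * prob E"
    and "h (k - 1) * prob E \<le> (h (k - 1) - h (k + 1)) * prob (path_event \<Phi>)"
proof -
  define mass where "mass m = prob (path_event (survives \<Phi> n m))" for m
  define energy where "energy m = (LINT \<omega>:path_event (survives \<Phi> n m)|M. h (Z (n + m) \<omega>))" for m
  have mass_lim: "mass \<longlonglongrightarrow> prob E"
    unfolding mass_def E_def by (rule prob_survives_tendsto[OF det])
  have energy_lim: "energy \<longlonglongrightarrow> 0"
    unfolding energy_def by (rule set_integral_survives_tendsto_0[OF det])
  have step: "h k * (mass m - mass (Suc m)) \<le> energy m - energy (Suc m)"
    "energy m - energy (Suc m) \<le> h (k - 1) * (mass m - mass (Suc m))" for m
    using survival_step_bounds[OF determined_upto_survives[OF det], of m]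
    by (simp_all add: mass_def energy_def survives_Suc) (auto simp: survives_def)
  have survives_0: "survives \<Phi> n 0 = \<Phi>" by (auto simp: survives_def fun_eq_iff dest: start)
  have mass_0: "mass 0 = prob (path_event \<Phi>)" by (simp add: mass_def survives_0)
  have energy_0: "energy 0 = h (k + 1) * mass 0"
  proof -
    have "energy 0 = (LINT \<omega>:path_event \<Phi>|M. h (k + 1))"
      unfolding energy_def survives_0
      by (intro set_lebesgue_integral_cong determined_path_event_sets[OF det])
        (auto simp: path_event_def dest: start)
    thus ?thesis
      using determined_path_event_sets[OF det] by (simp add: mass_0 set_lebesgue_integral_def)
  qed
  have "decseq (\<lambda>m. energy m - h k * mass m)"
    using step(1) by (intro decseq_SucI) (simp add: algebra_simps)
  moreover have "(\<lambda>m. energy m - h k * mass m) \<longlonglongrightarrow> 0 - h k * prob E"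
    by (intro tendsto_intros energy_lim mass_lim)
  ultimately have "0 - h k * prob E \<le> energy 0 - h k * mass 0" by (rule decseq_ge)
  thus "(h k - h (k + 1)) * prob (path_event \<Phi>) \<le> h k * prob E"
    by (simp add: energy_0 mass_0 algebra_simps)
  have "incseq (\<lambda>m. energy m - h (k - 1) * mass m)"
    using step(2) by (intro incseq_SucI) (simp add: algebra_simps)
  moreover have "(\<lambda>m. energy m - h (k - 1) * mass m) \<longlonglongrightarrow> 0 - h (k - 1) * prob E"
    by (intro tendsto_intros energy_lim mass_lim)
  ultimately have "energy 0 - h (k - 1) * mass 0 \<le> 0 - h (k - 1) * prob E" by (rule incseq_le)
  thus "h (k - 1) * prob E \<le> (h (k - 1) - h (k + 1)) * prob (path_event \<Phi>)"
    by (simp add: energy_0 mass_0 algebra_simps)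
qed

lemma ever_escape_prob_bounds:
  assumes det: "\<And>n. determined_upto (Suc n) (A n)" and start: "\<And>n p. A n p \<Longrightarrow> p (Suc n) = k + 1"
    and unique: "\<And>n m p. A n p \<Longrightarrow> A m p \<Longrightarrow> n = m"
  defines "E \<equiv> path_event (\<lambda>p. \<exists>n. A n p \<and> (\<forall>j\<ge>Suc n. p j > k))"
  shows "E \<in> events"
    and "(h k - h (k + 1)) * prob (path_event (\<lambda>p. \<exists>n. A n p)) \<le> h k * prob E"
    and "h (k - 1) * prob E \<le> (h (k - 1) - h (k + 1)) * prob (path_event (\<lambda>p. \<exists>n. A n p))"
proof -
  let ?E = "\<lambda>n. path_event (\<lambda>p. A n p \<and> (\<forall>j\<ge>Suc n. p j > k))"
  have E_sets: "?E n \<in> events" for n by (rule prob_survives_tendsto(1)[OF det])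
  have lower: "(h k - h (k + 1)) * prob (path_event (A n)) \<le> h k * prob (?E n)"
    and upper: "h (k - 1) * prob (?E n) \<le> (h (k - 1) - h (k + 1)) * prob (path_event (A n))" for n
    by (rule escape_prob_bounds[of "Suc n" "A n"], rule det, erule start)+
  show "E \<in> events" unfolding E_def by (rule path_event_Ex_sets) (rule E_sets)
  have A_sums: "(\<lambda>n. prob (path_event (A n))) sums prob (path_event (\<lambda>p. \<exists>n. A n p))"
    using determined_path_event_sets[OF det] unique by (rule sums_prob_path_event_Ex)
  have E_sums: "(\<lambda>n. prob (?E n)) sums prob E"
    unfolding E_def using E_sets unique by (intro sums_prob_path_event_Ex) blast+
  show "(h k - h (k + 1)) * prob (path_event (\<lambda>p. \<exists>n. A n p)) \<le> h k * prob E"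
    using lower by (rule sums_le[OF _ sums_mult[OF A_sums] sums_mult[OF E_sums]])
  show "h (k - 1) * prob E \<le> (h (k - 1) - h (k + 1)) * prob (path_event (\<lambda>p. \<exists>n. A n p))"
    using upper by (rule sums_le[OF _ sums_mult[OF E_sums] sums_mult[OF A_sums]])
qed

end

subsection \<open>Prescribed paths after a stopping time\<close>

primrec path_prob :: "nat \<Rightarrow> nat list \<Rightarrow> real" where
  "path_prob x [] = 1"
| "path_prob x (y # ys) = P x y * path_prob y ys"

lemma prob_follows:
  assumes "determined_upto n \<Phi>" "\<And>p. \<Phi> p \<Longrightarrow> p n = x"
  shows "prob (path_event (\<lambda>p. \<Phi> p \<and> follows n ys p)) = prob (path_event \<Phi>) * path_prob x ys"
  using assms
proof (induction ys arbitrary: n x \<Phi>)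
  case (Cons y ys)
  let ?\<Phi>' = "\<lambda>p. \<Phi> p \<and> p (Suc n) = y"
  have "(\<lambda>p. \<Phi> p \<and> p n = x \<and> p (Suc n) = y) = ?\<Phi>'" "(\<lambda>p. \<Phi> p \<and> p n = x) = \<Phi>"
    using Cons.prems(2) by (auto simp: fun_eq_iff)
  hence "prob (path_event ?\<Phi>') = prob (path_event \<Phi>) * P x y"
    using markov_property[OF Cons.prems(1), of x y] by simp
  moreover have "determined_upto (Suc n) ?\<Phi>'"
    using Cons.prems(1) unfolding determined_upto_def by (metis le_Suc_eq order_refl)
  hence "prob (path_event (\<lambda>p. ?\<Phi>' p \<and> follows (Suc n) ys p)) =
      prob (path_event ?\<Phi>') * path_prob y ys"
    by (rule Cons.IH) simp
  ultimately show ?case by simp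
qed simp

lemma prob_follows_ge:
  fixes ys :: "nat \<Rightarrow> nat list"
  assumes det: "determined_upto n \<Phi>" and lower: "\<And>p. \<Phi> p \<Longrightarrow> c \<le> path_prob (p n) (ys (p n))"
  defines "E \<equiv> path_event (\<lambda>p. \<Phi> p \<and> follows n (ys (p n)) p)"
  shows "E \<in> events" "c * prob (path_event \<Phi>) \<le> prob E"
proof -
  let ?E = "\<lambda>p. \<Phi> p \<and> follows n (ys (p n)) p"
  have det_at: "determined_upto n (\<lambda>p. \<Phi> p \<and> p n = x)" for x
    using det by (auto simp: determined_upto_def)
  have E_at: "(\<lambda>p. (\<Phi> p \<and> p n = x) \<and> follows n (ys x) p) = (\<lambda>p. ?E p \<and> p n = x)" for x
    by auto
  have "path_event (\<lambda>p. ?E p \<and> p n = x) \<in> events" for x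
    unfolding E_at[symmetric]
    by (rule determined_path_event_sets[OF determined_upto_follows[OF det_at]])
  thus E_sets: "E \<in> events"
    using path_event_Ex_sets[of "\<lambda>x p. ?E p \<and> p n = x"] by (simp add: E_def)
  have "c * prob (path_event (\<lambda>p. \<Phi> p \<and> p n = x)) \<le> prob (path_event (\<lambda>p. ?E p \<and> p n = x))" for x
  proof (cases "\<exists>p. \<Phi> p \<and> p n = x")
    case True
    hence "c \<le> path_prob x (ys x)" using lower by blast
    thus ?thesis
      using prob_follows[OF det_at, of x x "ys x"] unfolding E_at
      by (simp add: mult.commute mult_right_mono)
  next
    case False
    hence "path_event (\<lambda>p. \<Phi> p \<and> p n = x) = {}" by (auto simp: path_event_def)
    thus ?thesis by simp
  qed
  thus "c * prob (path_event \<Phi>) \<le> prob E"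
    unfolding E_def prob_path_event[OF determined_path_event_sets[OF det], of n]
      prob_path_event[OF E_sets[unfolded E_def], of n] sum_distrib_left
    by (rule sum_mono)
qed

lemma prob_stopped_path_ge:
  fixes T :: "nat \<Rightarrow> (nat \<Rightarrow> nat) \<Rightarrow> bool" and ys :: "nat \<Rightarrow> nat list"
  assumes det: "\<And>n. determined_upto n (T n)" and unique: "\<And>n m p. T n p \<Longrightarrow> T m p \<Longrightarrow> n = m"
    and stops: "AE \<omega> in M. \<exists>n. T n (\<lambda>i. Z i \<omega>)"
    and lower: "\<And>n p. T n p \<Longrightarrow> c \<le> path_prob (p n) (ys (p n))"
  shows "c \<le> prob (path_event (\<lambda>p. \<exists>n. T n p \<and> follows n (ys (p n)) p))"
proof -
  let ?E = "\<lambda>n p. T n p \<and> follows n (ys (p n)) p"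
  have T_sets: "path_event (T n) \<in> events" for n by (rule determined_path_event_sets) (rule det)
  have E_sets: "path_event (?E n) \<in> events"
    and step: "c * prob (path_event (T n)) \<le> prob (path_event (?E n))" for n
    by (rule prob_follows_ge[of n "T n" c ys], rule det, erule lower)+
  have "(\<lambda>n. prob (path_event (T n))) sums prob (path_event (\<lambda>p. \<exists>n. T n p))"
    using T_sets unique by (rule sums_prob_path_event_Ex)
  moreover have "prob (path_event (\<lambda>p. \<exists>n. T n p)) = 1"
    using path_event_Ex_sets[OF T_sets] stops by (subst prob_eq_1) (auto simp: path_event_def)
  ultimately have "(\<lambda>n. c * prob (path_event (T n))) sums c"
    using sums_mult[of "\<lambda>n. prob (path_event (T n))" 1 c] by simp
  moreover have "(\<lambda>n. prob (path_event (?E n))) sums prob (path_event (\<lambda>p. \<exists>n. ?E n p))"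
    using E_sets unique by (intro sums_prob_path_event_Ex) blast+
  ultimately show ?thesis by (rule sums_le[OF step])
qed

end

section \<open>Cutpoints of paths\<close>

lemma discrete_ivt:
  fixes f :: "nat \<Rightarrow> int"
  assumes jump: "\<And>i. f (Suc i) \<le> f i + 1" and "i \<le> j" "f i \<le> k" "k \<le> f j"
  obtains m where "i \<le> m" "m \<le> j" "f m = k"
proof -
  have "\<exists>m. i \<le> m \<and> m \<le> j \<and> f m = k"
    using assms(2-4)
  proof (induction j rule: dec_induct)
    case base
    thus ?case by (intro exI[of _ i]) auto
  next
    case (step j)
    show ?case
    proof (cases "k \<le> f j")
      case True
      thus ?thesis using step by (metis le_SucI)
    next
      case False
      hence "f (Suc j) = k" using jump[of j] step by simp
      thus ?thesis using step by (intro exI[of _ "Suc j"]) auto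
    qed
  qed
  thus ?thesis using that by blast
qed

definition first_passage :: "nat \<Rightarrow> nat \<Rightarrow> nat \<Rightarrow> (nat \<Rightarrow> nat) \<Rightarrow> bool" where
  "first_passage b k n p \<longleftrightarrow> k \<le> p n \<and> p n < k + b \<and> (\<forall>j<n. p j < k)"

lemma determined_upto_first_passage: "determined_upto n (first_passage b k n)"
  by (auto simp: determined_upto_def first_passage_def)

lemma first_passage_unique: "first_passage b k n p \<Longrightarrow> first_passage b k m p \<Longrightarrow> n = m"
proof (induction n m rule: linorder_wlog)
  case (le n m)
  have "\<not> n < m"
  proof
    assume "n < m"
    hence "p n < k" "k \<le> p n" using le by (simp_all add: first_passage_def)
    thus False by simp
  qed
  with le show ?case by simp
qed simp

lemma first_passage_exists:
  assumes transient: "filterlim p at_top sequentially" and "p 0 < k"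
    and jump: "\<And>i. p (Suc i) \<le> p i + b"
  obtains n where "first_passage b k n p"
proof -
  define n where "n = (LEAST n. k \<le> p n)"
  have "\<exists>n. k \<le> p n" using transient by (auto simp: filterlim_at_top eventually_sequentially)
  hence reached: "k \<le> p n" unfolding n_def by (rule LeastI_ex)
  have before: "p i < k" if "i < n" for i
    using not_less_Least[OF that[unfolded n_def]] by simp
  obtain m where "n = Suc m" using reached \<open>p 0 < k\<close> by (cases n) auto
  hence "p n < k + b" using before[of m] jump[of m] by simp
  thus ?thesis using reached before by (intro that[of n]) (simp add: first_passage_def)
qed

lemma (in nat_chain) prob_path_after_first_passage:
  assumes transient: "AE \<omega> in M. filterlim (\<lambda>n. Z n \<omega>) at_top sequentially" and "x0 < k"
    and jump: "\<And>x y. P x y \<noteq> 0 \<Longrightarrow> y \<le> x + b"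
    and lower: "\<And>x. k \<le> x \<Longrightarrow> x < k + b \<Longrightarrow> c \<le> path_prob x (ys x)"
  shows "c \<le> prob (path_event (\<lambda>p. \<exists>n. first_passage b k n p \<and> follows n (ys (p n)) p))"
proof (rule prob_stopped_path_ge[where T = "first_passage b k" and ys = ys])
  show "AE \<omega> in M. \<exists>n. first_passage b k n (\<lambda>i. Z i \<omega>)"
    using transient AE_start AE_step
  proof eventually_elim
    case (elim \<omega>)
    have "Z 0 \<omega> < k" using elim(2) \<open>x0 < k\<close> by simp
    moreover have "Z (Suc i) \<omega> \<le> Z i \<omega> + b" for i using elim(3) jump by blast
    ultimately obtain n where "first_passage b k n (\<lambda>i. Z i \<omega>)"
      by (rule first_passage_exists[OF elim(1)])
    thus ?case by blast
  qed
  show "c \<le> path_prob (p n) (ys (p n))" if "first_passage b k n p" for n p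
    using that by (intro lower) (simp_all add: first_passage_def)
qed (rule determined_upto_first_passage, erule first_passage_unique)

definition cut_step :: "bool \<Rightarrow> nat \<Rightarrow> nat \<Rightarrow> (nat \<Rightarrow> nat) \<Rightarrow> bool" where
  "cut_step isX k n p \<longleftrightarrow> p n = (if isX then k else k - 1) \<and> (\<forall>j<n. p j < k) \<and> p (Suc n) = k + 1"

lemma determined_upto_cut_step: "determined_upto (Suc n) (cut_step isX k n)"
  by (auto simp: determined_upto_def cut_step_def)

lemma cut_step_unique: "cut_step isX k n p \<Longrightarrow> cut_step isX k m p \<Longrightarrow> n = m"
proof (induction n m rule: linorder_wlog)
  case (le n m)
  show ?case
  proof (rule ccontr)
    assume "n \<noteq> m"
    hence "Suc n < m \<or> Suc n = m" using le by auto
    thus False using le by (auto simp: cut_step_def split: if_splits)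
  qed
qed auto

lemma is_cutpoint_X_iff:
  assumes "p 0 = 2" and up: "\<And>i. p (Suc i) \<le> p i + 1"
    and transient: "filterlim p at_top sequentially" and "k \<ge> 2"
  shows "is_cutpoint True p k \<longleftrightarrow> (\<exists>n. cut_step True k n p \<and> (\<forall>j\<ge>Suc n. p j > k))"
proof
  assume "is_cutpoint True p k"
  then obtain n where "{n. p n = k} = {n}"
    by (auto simp: is_cutpoint_def card_1_singleton_iff)
  hence visits: "p n = k" "\<And>m. p m = k \<Longrightarrow> m = n" by auto
  have up_int: "int (p (Suc i)) \<le> int (p i) + 1" for i using up[of i] by simp
  have below: "p j < k" if "j < n" for j
  proof (rule ccontr)
    assume "\<not> p j < k"
    with discrete_ivt[of "\<lambda>i. int (p i)" 0 j k, OF up_int] assms obtain m where "m \<le> j" "p m = k"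
      by auto
    with visits(2)[of m] that show False by simp
  qed
  have above: "p j > k" if "j \<ge> Suc n" for j
  proof (rule ccontr)
    assume "\<not> p j > k"
    have "eventually (\<lambda>l. k \<le> p l) sequentially" using transient by (simp add: filterlim_at_top)
    from eventually_conj[OF this eventually_ge_at_top[of j]]
    obtain l where "k \<le> p l" "j \<le> l" by (auto dest: eventually_happens)
    with discrete_ivt[of "\<lambda>i. int (p i)" j l k, OF up_int] \<open>\<not> p j > k\<close>
    obtain m where "j \<le> m" "p m = k"
      by auto
    with visits(2)[of m] that show False by simp
  qed
  have "p (Suc n) = k + 1" using above[of "Suc n"] up[of n] visits(1) by simp
  thus "\<exists>n. cut_step True k n p \<and> (\<forall>j\<ge>Suc n. p j > k)"
    using visits(1) below above by (auto simp: cut_step_def intro!: exI[of _ n])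
next
  assume "\<exists>n. cut_step True k n p \<and> (\<forall>j\<ge>Suc n. p j > k)"
  then obtain n where crossing: "p n = k" "\<And>j. j < n \<Longrightarrow> p j < k" "\<And>j. j \<ge> Suc n \<Longrightarrow> p j > k"
    by (auto simp: cut_step_def)
  have "m = n" if "p m = k" for m
    using crossing(2)[of m] crossing(3)[of m] that by (cases m n rule: linorder_cases) auto
  hence "{m. p m = k} = {n}" using crossing(1) by blast
  thus "is_cutpoint True p k" by (simp add: is_cutpoint_def)
qed

lemma is_cutpoint_Y_iff:
  assumes "p 0 = 2" and down: "\<And>i. p i \<le> p (Suc i) + 1" and up: "\<And>i. p (Suc i) \<le> p i + 2"
    and transient: "filterlim p at_top sequentially" and "k \<ge> 3"
  shows "is_cutpoint False p k \<longleftrightarrow> (\<exists>n. cut_step False k n p \<and> (\<forall>j\<ge>Suc n. p j > k))"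
proof
  assume "is_cutpoint False p k"
  hence avoids: "p n \<noteq> k" for n by (simp add: is_cutpoint_def)
  have "p 0 < k" using assms by simp
  then obtain i where "first_passage 2 k i p" by (rule first_passage_exists[OF transient _ up])
  hence reaches: "k \<le> p i" "\<And>j. j < i \<Longrightarrow> p j < k" by (simp_all add: first_passage_def)
  obtain n where i_eq: "i = Suc n" using reaches(1) assms by (cases i) auto
  have "p n < k" using reaches(2)[of n] i_eq by simp
  hence crossing: "p n = k - 1" "p (Suc n) = k + 1"
    using up[of n] reaches(1) avoids[of i] i_eq by auto
  have above: "p j > k" if after: "j \<ge> Suc n" for j
  proof (rule ccontr)
    assume "\<not> p j > k"
    have "- int (p (Suc i)) \<le> - int (p i) + 1" for i using down[of i] by simp
    then obtain m where "- int (p m) = - int k"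
      by (rule discrete_ivt[of "\<lambda>i. - int (p i)" "Suc n" j "- int k"])
        (use crossing after \<open>\<not> p j > k\<close> in auto)
    with avoids show False by simp
  qed
  show "\<exists>n. cut_step False k n p \<and> (\<forall>j\<ge>Suc n. p j > k)"
    using crossing reaches(2) i_eq above by (auto simp: cut_step_def intro!: exI[of _ n])
next
  assume "\<exists>n. cut_step False k n p \<and> (\<forall>j\<ge>Suc n. p j > k)"
  then obtain n where crossing: "p n = k - 1" "\<And>j. j < n \<Longrightarrow> p j < k" "\<And>j. j \<ge> Suc n \<Longrightarrow> p j > k"
    by (auto simp: cut_step_def)
  have "p m \<noteq> k" for m
    using crossing(1) crossing(2)[of m] crossing(3)[of m] \<open>k \<ge> 3\<close>
    by (cases m n rule: linorder_cases) auto
  thus "is_cutpoint False p k" by (simp add: is_cutpoint_def)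
qed

lemma is_cutpoint_sets:
  assumes [measurable]: "\<And>n. Z n \<in> M \<rightarrow>\<^sub>M count_space (UNIV :: nat set)"
  shows "{\<omega> \<in> space M. is_cutpoint isX (\<lambda>i. Z i \<omega>) k} \<in> sets M"
proof (cases isX)
  case True
  have "is_cutpoint isX p k \<longleftrightarrow> (\<exists>n. p n = k \<and> (\<forall>m. p m = k \<longrightarrow> m = n))" for p
    using True by (auto simp: is_cutpoint_def card_1_singleton_iff)
  thus ?thesis by simp
qed (simp add: is_cutpoint_def)

section \<open>Cutpoint probabilities\<close>

lemma trans_kernel_eq_0: "x + 2 < y \<Longrightarrow> trans_kernel isX q p1 p2 x y = 0"
  by (auto simp: trans_kernel_def)

lemma trans_kernel_X_nonzero:
  assumes "trans_kernel True q p1 p2 x y \<noteq> 0"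
  shows "y \<le> x + 1" "x \<le> y + 2"
  using assms by (auto simp: trans_kernel_def split: if_splits)

lemma trans_kernel_Y_nonzero:
  assumes "trans_kernel False q p1 p2 x y \<noteq> 0"
  shows "y \<le> x + 2" "x \<le> y + 1"
  using assms by (auto simp: trans_kernel_def split: if_splits)

lemma sum_trans_kernel:
  assumes "x \<ge> 2"
  shows "(\<Sum>y\<le>x+2. trans_kernel isX q p1 p2 x y * f y) =
    (if isX then q x * f (x + 1) + p1 x * f (x - 1) + p2 x * f (x - 2)
     else q x * f (x - 1) + p1 x * f (x + 1) + p2 x * f (x + 2))"
proof -
  let ?targets = "if isX then {x + 1, x - 1, x - 2} else {x - 1, x + 1, x + 2}"
  have "(\<Sum>y\<le>x+2. trans_kernel isX q p1 p2 x y * f y) =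
      (\<Sum>y\<in>?targets. trans_kernel isX q p1 p2 x y * f y)"
    by (rule sum.mono_neutral_right) (use assms in \<open>auto simp: trans_kernel_def split: if_splits\<close>)
  moreover obtain m where "x = Suc (Suc m)" using assms by (metis add_2_eq_Suc le_Suc_ex)
  ultimately show ?thesis by (simp add: trans_kernel_def)
qed

lemma sum_trans_kernel_boundary:
  "(\<Sum>y\<le>2. trans_kernel isX q p1 p2 0 y * f y) = (if isX then f 1 else f 2)"
  "(\<Sum>y\<le>3. trans_kernel isX q p1 p2 1 y * f y) = (if isX then f 2 else f 0)"
  by (simp_all add: trans_kernel_def atMost_Suc numeral_eq_Suc)

lemma (in step_probabilities) trans_kernel_nonneg: "trans_kernel isX q p1 p2 x y \<ge> 0"
proof (cases "x \<ge> 2")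
  case True
  thus ?thesis
    unfolding trans_kernel_def if_distrib[of "\<lambda>t. 0 \<le> t"]
    by (simp only: q_pos[OF True] p1_nonneg[OF True] p2_pos[OF True] less_imp_le zero_le_one
        order_refl if_cancel)
next
  case False
  hence "x = 0 \<or> x = 1" by linarith
  thus ?thesis by (elim disjE) (simp_all add: trans_kernel_def)
qed

lemma (in step_probabilities) trans_kernel_sum_1: "(\<Sum>y\<le>x+2. trans_kernel isX q p1 p2 x y) = 1"
proof -
  consider "x = 0" | "x = 1" | "x \<ge> 2" by linarith
  thus ?thesis
  proof cases
    case 3
    thus ?thesis using probs_sum[OF 3] sum_trans_kernel[OF 3, of isX q p1 p2 "\<lambda>_. 1"]
      by (cases isX) simp_all
  qed (simp_all add: trans_kernel_def)
qed

definition (in step_probabilities) cut_step_bound :: "bool \<Rightarrow> nat \<Rightarrow> real" where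
  "cut_step_bound isX k = (if isX then q k else q (k - 2) * p2 (k - 3) * p2 (k - 1))"

locale skip_walk = step_probabilities q p1 p2 for q p1 p2 :: "nat \<Rightarrow> real" +
  fixes isX :: bool and M :: "'a measure" and Z :: "nat \<Rightarrow> 'a \<Rightarrow> nat"
  assumes walk: "is_markov_chain M Z 2 (trans_kernel isX q p1 p2)"

sublocale skip_walk \<subseteq> nat_chain M Z 2 "trans_kernel isX q p1 p2" 2
  by unfold_locales (use walk trans_kernel_nonneg trans_kernel_sum_1 trans_kernel_eq_0 in auto)

context skip_walk
begin

definition cut_event :: "nat \<Rightarrow> 'a set" where
  "cut_event k = {\<omega> \<in> space M. is_cutpoint isX (\<lambda>i. Z i \<omega>) k}"

lemma cut_event_sets [measurable]: "cut_event k \<in> events"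
  unfolding cut_event_def by (rule is_cutpoint_sets) (rule measurable_Z)

lemma prob_cut_step_ge_X:
  assumes transient: "AE \<omega> in M. filterlim (\<lambda>n. Z n \<omega>) at_top sequentially"
    and "isX" "k \<ge> 3"
  shows "cut_step_bound isX k \<le> prob (path_event (\<lambda>p. \<exists>n. cut_step isX k n p))"
proof -
  have "q k \<le> prob (path_event (\<lambda>p. \<exists>n. first_passage 1 k n p \<and> follows n [k + 1] p))"
  proof (rule prob_path_after_first_passage[OF transient, where ys = "\<lambda>_. [k + 1]"])
    show "y \<le> x + 1" if "trans_kernel isX q p1 p2 x y \<noteq> 0" for x y
      using that \<open>isX\<close> trans_kernel_X_nonzero(1)[of q p1 p2] by simp
    show "q k \<le> path_prob x [k + 1]" if "k \<le> x" "x < k + 1" for x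
    proof -
      have "x = k" using that by simp
      thus ?thesis unfolding path_prob.simps using assms by (simp add: trans_kernel_def)
    qed
  qed (use \<open>k \<ge> 3\<close> in simp)
  moreover have "first_passage 1 k n p \<and> follows n [k + 1] p \<longleftrightarrow> cut_step isX k n p" for n p
    using \<open>isX\<close> by (auto simp: first_passage_def cut_step_def)
  ultimately show ?thesis using \<open>isX\<close> by (simp add: cut_step_bound_def)
qed

text \<open>The first passage above \<open>k - 3\<close> lands on \<open>k - 1\<close> or \<open>k - 2\<close>; in the second case the
  detour \<open>k - 2, k - 3, k - 1\<close> avoids \<open>k\<close>. From \<open>k - 1\<close> the walk then jumps over \<open>k\<close>.\<close>

lemma cut_step_after_first_passage:
  assumes first: "first_passage 2 (k - 2) n p" and "k \<ge> 3"
    and path: "follows n (if p n = k - 1 then [k + 1] else [k - 3, k - 1, k + 1]) p"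
  shows "\<exists>n. cut_step False k n p"
proof -
  have below: "p j < k" if "j < n" for j
  proof -
    have "p j < k - 2" using first that by (simp add: first_passage_def)
    thus ?thesis by simp
  qed
  show ?thesis
  proof (cases "p n = k - 1")
    case True
    hence "cut_step False k n p" using below path by (simp add: cut_step_def)
    thus ?thesis by blast
  next
    case False
    hence detour: "p n = k - 2" "p (Suc n) = k - 3" "p (Suc (Suc n)) = k - 1"
      "p (Suc (Suc (Suc n))) = k + 1"
      using first path \<open>k \<ge> 3\<close> by (auto simp: first_passage_def)
    have "p j < k" if "j < Suc (Suc n)" for j
    proof -
      consider "j < n" | "j = n" | "j = Suc n" using \<open>j < Suc (Suc n)\<close> by linarith
      thus ?thesis using below detour \<open>k \<ge> 3\<close> by cases simp_all
    qed
    hence "cut_step False k (Suc (Suc n)) p" using detour by (simp add: cut_step_def)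
    thus ?thesis by blast
  qed
qed

lemma path_prob_over_k_ge:
  assumes "\<not> isX" "k \<ge> 5"
  shows "q (k - 2) * p2 (k - 3) * p2 (k - 1) \<le> path_prob (k - 1) [k + 1]"
    and "q (k - 2) * p2 (k - 3) * p2 (k - 1) \<le> path_prob (k - 2) [k - 3, k - 1, k + 1]"
proof -
  obtain m where k_eq: "k = m + 5" using \<open>k \<ge> 5\<close> by (metis add.commute le_Suc_ex)
  have near: "k - 1 = m + 4" "k - 2 = m + 3" "k - 3 = m + 2" "k + 1 = m + 6" using k_eq by simp_all
  have "q (m + 3) * p2 (m + 2) \<le> 1 * 1"
    using probs[of "m + 2"] probs[of "m + 3"] by (intro mult_mono) auto
  hence at_most: "q (m + 3) * p2 (m + 2) * p2 (m + 4) \<le> 1 * p2 (m + 4)"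
    using p2_pos[of "m + 4"] by (intro mult_right_mono) auto
  have weights: "path_prob (m + 4) [m + 6] = p2 (m + 4)"
    "path_prob (m + 3) [m + 2, m + 4, m + 6] = q (m + 3) * p2 (m + 2) * p2 (m + 4)"
    by (simp_all only: path_prob.simps) (use \<open>\<not> isX\<close> in \<open>simp_all add: trans_kernel_def\<close>)
  show "q (k - 2) * p2 (k - 3) * p2 (k - 1) \<le> path_prob (k - 1) [k + 1]"
    "q (k - 2) * p2 (k - 3) * p2 (k - 1) \<le> path_prob (k - 2) [k - 3, k - 1, k + 1]"
    unfolding near weights using at_most by simp_all
qed

lemma prob_cut_step_ge_Y:
  assumes transient: "AE \<omega> in M. filterlim (\<lambda>n. Z n \<omega>) at_top sequentially"
    and "\<not> isX" "k \<ge> 5"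
  shows "cut_step_bound isX k \<le> prob (path_event (\<lambda>p. \<exists>n. cut_step isX k n p))"
proof -
  define ys where "ys x = (if x = k - 1 then [k + 1] else [k - 3, k - 1, k + 1])" for x
  have "q (k - 2) * p2 (k - 3) * p2 (k - 1) \<le>
      prob (path_event (\<lambda>p. \<exists>n. first_passage 2 (k - 2) n p \<and> follows n (ys (p n)) p))"
  proof (rule prob_path_after_first_passage[OF transient])
    show "y \<le> x + 2" if "trans_kernel isX q p1 p2 x y \<noteq> 0" for x y
      using that \<open>\<not> isX\<close> trans_kernel_Y_nonzero(1)[of q p1 p2] by simp
    show "q (k - 2) * p2 (k - 3) * p2 (k - 1) \<le> path_prob x (ys x)"
      if "k - 2 \<le> x" "x < k - 2 + 2" for x
    proof -
      have "x = k - 2 \<or> x = k - 1" using that \<open>k \<ge> 5\<close> by linarith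
      moreover have "ys (k - 1) = [k + 1]" "ys (k - 2) = [k - 3, k - 1, k + 1]"
        using \<open>k \<ge> 5\<close> by (auto simp: ys_def)
      ultimately show ?thesis
        using path_prob_over_k_ge[OF assms(2,3)] by (elim disjE) (simp_all only:)
    qed
  qed (use \<open>k \<ge> 5\<close> in simp)
  also have "\<dots> \<le> prob (path_event (\<lambda>p. \<exists>n. cut_step isX k n p))"
  proof (rule finite_measure_mono)
    have "\<exists>n. cut_step isX k n p" if "first_passage 2 (k - 2) n p" "follows n (ys (p n)) p" for n p
      using cut_step_after_first_passage[OF that(1) _ that(2)[unfolded ys_def]] \<open>\<not> isX\<close> \<open>k \<ge> 5\<close>
      by simp
    thus "path_event (\<lambda>p. \<exists>n. first_passage 2 (k - 2) n p \<and> follows n (ys (p n)) p)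
        \<subseteq> path_event (\<lambda>p. \<exists>n. cut_step isX k n p)"
      unfolding path_event_def by blast
    show "path_event (\<lambda>p. \<exists>n. cut_step isX k n p) \<in> events"
      by (intro path_event_Ex_sets determined_path_event_sets) (rule determined_upto_cut_step)
  qed
  finally show ?thesis using \<open>\<not> isX\<close> by (simp add: cut_step_bound_def)
qed

end

text \<open>\<open>Y\<close> moves from \<open>1\<close> to \<open>0\<close> and from \<open>0\<close> to \<open>2\<close>, so a strictly decreasing \<open>h\<close> that is harmonic
  above \<open>1\<close> is superharmonic only once \<open>h 0\<close> is moved between \<open>h 2\<close> and \<open>h 1\<close>.\<close>

definition walk_potential :: "bool \<Rightarrow> (nat \<Rightarrow> real) \<Rightarrow> nat \<Rightarrow> real" where
  "walk_potential isX h k = (if \<not> isX \<and> k = 0 then (h 1 + h 2) / 2 else h k)"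

locale harmonic_walk = skip_walk q p1 p2 isX M Z
  for q p1 p2 :: "nat \<Rightarrow> real" and isX :: bool and M :: "'a measure" and Z :: "nat \<Rightarrow> 'a \<Rightarrow> nat" +
  fixes u :: "nat \<Rightarrow> real"
  assumes u_pos: "\<And>n. u n > 0" and u_summable: "summable u"
    and u_harmonic: "harmonic_increments isX u"
begin

abbreviation h :: "nat \<Rightarrow> real" where
  "h \<equiv> tail_sum u"

lemma h_rec: "h k = u k + h (Suc k)"
  by (rule tail_sum_Suc[OF u_summable])

lemma h_pos: "h k > 0"
  by (rule tail_sum_pos[OF u_summable u_pos])

lemma h_Suc_less: "h (Suc k) < h k"
  using h_rec[of k] u_pos[of k] by simp

abbreviation potential :: "nat \<Rightarrow> real" where
  "potential \<equiv> walk_potential isX h"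

lemma potential_eq_h: "k \<ge> 1 \<Longrightarrow> potential k = h k"
  by (simp add: walk_potential_def)

lemma potential_pos: "potential k > 0"
  using h_pos by (simp add: walk_potential_def add_pos_pos)

lemma potential_tendsto_0: "potential \<longlonglongrightarrow> 0"
  by (rule Lim_transform_eventually[OF tail_sum_tendsto_0[OF u_summable]])
    (use eventually_ge_at_top[of 1] in eventually_elim, simp add: potential_eq_h)

lemma h_harmonic_X:
  assumes "isX" "x \<ge> 2"
  shows "q x * h (x + 1) + p1 x * h (x - 1) + p2 x * h (x - 2) = h x"
proof -
  have "u x = coeff_a x * u (x - 1) + coeff_b x * u (x - 2)"
    using u_harmonic assms by (simp add: harmonic_increments_def)
  hence balance: "q x * u x = (p1 x + p2 x) * u (x - 1) + p2 x * u (x - 2)"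
    using q_pos[OF \<open>x \<ge> 2\<close>] by (simp add: coeff_a_def coeff_b_def field_simps)
  have near: "h (x + 1) = h x - u x" "h (x - 1) = h x + u (x - 1)"
    "h (x - 2) = h x + u (x - 1) + u (x - 2)"
    using h_rec[of x] h_rec[of "x - 1"] h_rec[of "x - 2"] assms
    by (simp_all add: Suc_diff_le numeral_2_eq_2 Suc_diff_Suc)
  have "q x * h (x + 1) + p1 x * h (x - 1) + p2 x * h (x - 2) =
      (q x + p1 x + p2 x) * h x + ((p1 x + p2 x) * u (x - 1) + p2 x * u (x - 2) - q x * u x)"
    unfolding near by (simp add: algebra_simps)
  thus ?thesis using balance probs_sum[OF \<open>x \<ge> 2\<close>] by simp
qed

lemma h_harmonic_Y:
  assumes "\<not> isX" "x \<ge> 2"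
  shows "q x * h (x - 1) + p1 x * h (x + 1) + p2 x * h (x + 2) = h x"
proof -
  have "u (x - 1) = coeff_a x * u x + coeff_b x * u (x + 1)"
    using u_harmonic assms by (simp add: harmonic_increments_def)
  hence balance: "q x * u (x - 1) = (p1 x + p2 x) * u x + p2 x * u (x + 1)"
    using q_pos[OF \<open>x \<ge> 2\<close>] by (simp add: coeff_a_def coeff_b_def field_simps)
  have near: "h (x - 1) = h x + u (x - 1)" "h (x + 1) = h x - u x"
    "h (x + 2) = h x - u x - u (x + 1)"
    using h_rec[of "x - 1"] h_rec[of x] h_rec[of "x + 1"] assms by simp_all
  have "q x * h (x - 1) + p1 x * h (x + 1) + p2 x * h (x + 2) =
      (q x + p1 x + p2 x) * h x + (q x * u (x - 1) - ((p1 x + p2 x) * u x + p2 x * u (x + 1)))"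
    unfolding near by (simp add: algebra_simps)
  thus ?thesis using balance probs_sum[OF \<open>x \<ge> 2\<close>] by simp
qed

lemma potential_harmonic:
  assumes "x \<ge> 2"
  shows "step_mean potential x = potential x"
  using assms h_harmonic_X[OF _ assms] h_harmonic_Y[OF _ assms]
  unfolding step_mean_def sum_trans_kernel[OF assms] by (simp add: walk_potential_def)

lemma potential_superharmonic: "step_mean potential x \<le> potential x"
proof -
  consider "x = 0" | "x = 1" | "x \<ge> 2" by linarith
  thus ?thesis
  proof cases
    case 1
    hence "step_mean potential x = (if isX then h 1 else h 2)"
      by (simp only: step_mean_def add_0 one_plus_numeral add_num_simps sum_trans_kernel_boundary)
        (simp add: walk_potential_def)
    thus ?thesis
      using 1 h_Suc_less[of 0] h_Suc_less[of 1] by (simp add: walk_potential_def numeral_2_eq_2)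
  next
    case 2
    hence "step_mean potential x = (if isX then h 2 else (h 1 + h 2) / 2)"
      by (simp only: step_mean_def add_0 one_plus_numeral add_num_simps sum_trans_kernel_boundary)
        (simp add: walk_potential_def)
    thus ?thesis using 2 h_Suc_less[of 1] by (simp add: walk_potential_def numeral_2_eq_2)
  qed (simp add: potential_harmonic)
qed

lemma potential_nonconstant: "\<exists>y. trans_kernel isX q p1 p2 x y > 0 \<and> potential y \<noteq> potential x"
proof (cases "isX \<or> x = 0")
  case True
  define y where "y = (if isX then Suc x else 2)"
  have "trans_kernel isX q p1 p2 x y > 0"
    using True q_pos[of x] by (auto simp: y_def trans_kernel_def)
  moreover have "potential y \<noteq> potential x"
    using True h_Suc_less[of x] h_Suc_less[of 1]
    by (auto simp: y_def walk_potential_def numeral_2_eq_2)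
  ultimately show ?thesis by blast
next
  case False
  then obtain y where x_eq: "x = Suc y" by (cases x) auto
  have "trans_kernel isX q p1 p2 x y > 0"
    using False q_pos[of x] by (auto simp: x_eq trans_kernel_def)
  moreover have "potential y \<noteq> potential x"
    using False h_Suc_less[of y] h_Suc_less[of 1]
    by (auto simp: x_eq walk_potential_def numeral_2_eq_2)
  ultimately show ?thesis by blast
qed

lemma AE_transient: "AE \<omega> in M. filterlim (\<lambda>n. Z n \<omega>) at_top sequentially"
proof (rule AE_at_top[of "\<lambda>x. sqrt (potential x)"])
  show "step_mean (\<lambda>x. sqrt (potential x)) x < sqrt (potential x)" for x
    using potential_nonconstant[of x] step_mean_sqrt_less[of potential x] potential_pos
      potential_superharmonic
    by blast
qed (simp add: potential_pos less_imp_le)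

lemma AE_is_cutpoint_iff:
  assumes "k \<ge> 3"
  shows "AE \<omega> in M. is_cutpoint isX (\<lambda>i. Z i \<omega>) k \<longleftrightarrow>
    (\<exists>n. cut_step isX k n (\<lambda>i. Z i \<omega>) \<and> (\<forall>j\<ge>Suc n. Z j \<omega> > k))"
  using AE_transient AE_start AE_step
proof eventually_elim
  case (elim \<omega>)
  show ?case
  proof (cases isX)
    case True
    have "Z (Suc i) \<omega> \<le> Z i \<omega> + 1" for i using elim(3) True trans_kernel_X_nonzero(1) by metis
    thus ?thesis using is_cutpoint_X_iff[of "\<lambda>i. Z i \<omega>" k] elim assms True by simp
  next
    case False
    have "Z (Suc i) \<omega> \<le> Z i \<omega> + 2" "Z i \<omega> \<le> Z (Suc i) \<omega> + 1" for i
      using elim(3) False trans_kernel_Y_nonzero by metis+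
    thus ?thesis using is_cutpoint_Y_iff[of "\<lambda>i. Z i \<omega>" k] elim assms False by simp
  qed
qed

lemma prob_cut_event_bounds:
  assumes "k \<ge> 3"
  shows "u k * prob (path_event (\<lambda>p. \<exists>n. cut_step isX k n p)) \<le> h k * prob (cut_event k)"
    and "h (k - 1) * prob (cut_event k) \<le> u (k - 1) + u k"
proof -
  define E where "E = path_event (\<lambda>p. \<exists>n. cut_step isX k n p \<and> (\<forall>j\<ge>Suc n. p j > k))"
  let ?crossing = "prob (path_event (\<lambda>p. \<exists>n. cut_step isX k n p))"
  have h_near: "h (k - 1) = u (k - 1) + u k + h (k + 1)" "h k = u k + h (k + 1)"
    using h_rec[of "k - 1"] h_rec[of k] assms by simp_all
  have potential_near: "potential (k - 1) = h (k - 1)" "potential k = h k"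
    "potential (k + 1) = h (k + 1)"
    using assms by (simp_all add: potential_eq_h)
  have step_down: "k - 1 \<le> y" if "x > k" "trans_kernel isX q p1 p2 x y \<noteq> 0" for x y
    using that trans_kernel_X_nonzero(2)[of q p1 p2 x y] trans_kernel_Y_nonzero(2)[of q p1 p2 x y]
    by (cases isX) auto
  have potential_le: "potential k \<le> potential (k - 1)"
    using u_pos[of "k - 1"] unfolding potential_near h_near by simp
  have harmonic: "step_mean potential x = potential x" if "x > k" for x
    using that assms by (simp add: potential_harmonic)
  have start: "p (Suc n) = k + 1" if "cut_step isX k n p" for n p
    using that by (simp add: cut_step_def)
  have bounds: "E \<in> events" "(potential k - potential (k + 1)) * ?crossing \<le> potential k * prob E"
    "potential (k - 1) * prob E \<le> (potential (k - 1) - potential (k + 1)) * ?crossing"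
    unfolding E_def
    by (rule ever_escape_prob_bounds[where h = potential];
        fact less_imp_le[OF potential_pos] potential_tendsto_0 potential_le harmonic step_down
          AE_transient determined_upto_cut_step start cut_step_unique)+
  have "prob (cut_event k) = prob E"
  proof (rule finite_measure_eq_AE[OF _ cut_event_sets bounds(1)])
    show "AE \<omega> in M. (\<omega> \<in> cut_event k) = (\<omega> \<in> E)"
      using AE_is_cutpoint_iff[OF assms]
      by eventually_elim (auto simp: cut_event_def E_def path_event_def)
  qed
  thus "u k * ?crossing \<le> h k * prob (cut_event k)"
    using bounds(2) unfolding potential_near h_near(2) by simp
  have "(u (k - 1) + u k) * ?crossing \<le> (u (k - 1) + u k) * 1"
    using u_pos by (intro mult_left_mono) (auto simp: add_nonneg_nonneg less_imp_le)
  thus "h (k - 1) * prob (cut_event k) \<le> u (k - 1) + u k"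
    using bounds(3) unfolding \<open>prob (cut_event k) = prob E\<close> potential_near h_near(1) by simp
qed

end

section \<open>Asymptotics of the number of cutpoints\<close>

lemma (in critical_walk) cut_step_bound_limit:
  obtains c where "c > 0" "cut_step_bound isX \<longlonglongrightarrow> c"
proof -
  obtain Q R where limits: "Q > 0" "R > 0" "q \<longlonglongrightarrow> Q" "p2 \<longlonglongrightarrow> R" by (rule q_p2_limits)
  have shift: "(\<lambda>k. f (k - m)) \<longlonglongrightarrow> L" if "f \<longlonglongrightarrow> L" for f :: "nat \<Rightarrow> real" and m L
    by (rule filterlim_compose[OF that filterlim_minus_const_nat_at_top])
  have "(\<lambda>k. q (k - 2) * p2 (k - 3) * p2 (k - 1)) \<longlonglongrightarrow> Q * R * R"
    by (intro tendsto_mult shift limits)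
  hence "cut_step_bound isX \<longlonglongrightarrow> (if isX then Q else Q * R * R)"
    using limits(3) by (simp add: cut_step_bound_def[abs_def])
  thus ?thesis using limits by (intro that) auto
qed

locale critical_harmonic_walk = harmonic_walk q p1 p2 isX M Z u + critical_walk q p1 p2 isX \<beta>
  for q p1 p2 :: "nat \<Rightarrow> real" and isX :: bool and M :: "'a measure" and Z :: "nat \<Rightarrow> 'a \<Rightarrow> nat"
    and u :: "nat \<Rightarrow> real" and \<beta> :: real
begin

definition relative_increment :: "nat \<Rightarrow> real" where
  "relative_increment k = u k * cut_scale \<beta> k / h k"

lemma relative_increment_tendsto_1: "relative_increment \<longlonglongrightarrow> 1"
  unfolding relative_increment_def
  using cut_scale_tail_sum_tendsto_1(2)[OF u_pos increment_ratio_asymptotics[OF u_pos u_harmonic]] .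

lemma increment_ratio_tendsto_1: "(\<lambda>k. u (Suc k) / u k) \<longlonglongrightarrow> 1"
proof -
  have "(\<lambda>n. u n / u (n - 1) - (1 + - 3 * r_seq \<beta> n)) \<in> O(\<lambda>n. (r_seq \<beta> n)\<^sup>2)"
    using increment_ratio_asymptotics[OF u_pos u_harmonic] by simp
  from tendsto_1_of_linear_asymptotics[OF this r_seq_tendsto_0]
  show ?thesis by (subst (asm) filterlim_sequentially_Suc[symmetric]) simp
qed

lemma prob_cut_event_lower:
  obtains c where "c > 0" "eventually (\<lambda>k. c / cut_scale \<beta> k \<le> prob (cut_event k)) sequentially"
proof -
  obtain c where bound_limit: "c > 0" "cut_step_bound isX \<longlonglongrightarrow> c" by (rule cut_step_bound_limit)
  have "(\<lambda>k. cut_step_bound isX k * relative_increment k) \<longlonglongrightarrow> c * 1"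
    by (intro tendsto_mult bound_limit relative_increment_tendsto_1)
  hence "eventually (\<lambda>k. c / 2 < cut_step_bound isX k * relative_increment k) sequentially"
    using bound_limit(1) by (intro order_tendstoD(1)[of _ "c * 1"]) auto
  hence "eventually (\<lambda>k. c / 2 / cut_scale \<beta> k \<le> prob (cut_event k)) sequentially"
    using eventually_ge_at_top[of 5]
  proof eventually_elim
    case (elim k)
    have scale_pos: "cut_scale \<beta> k > 0" using elim by (intro cut_scale_pos) simp
    have "cut_step_bound isX k \<le> prob (path_event (\<lambda>p. \<exists>n. cut_step isX k n p))"
      using prob_cut_step_ge_X[OF AE_transient] prob_cut_step_ge_Y[OF AE_transient] elim
      by (cases isX) auto
    hence "u k * cut_step_bound isX k \<le> u k * prob (path_event (\<lambda>p. \<exists>n. cut_step isX k n p))"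
      using u_pos[of k] by (intro mult_left_mono) auto
    also have "\<dots> \<le> h k * prob (cut_event k)" using elim by (intro prob_cut_event_bounds) simp
    finally have "cut_step_bound isX k * relative_increment k \<le> prob (cut_event k) * cut_scale \<beta> k"
      using h_pos[of k] scale_pos by (simp add: relative_increment_def field_simps)
    with elim have "c / 2 \<le> prob (cut_event k) * cut_scale \<beta> k" by linarith
    thus ?case using scale_pos by (simp add: field_simps)
  qed
  with bound_limit(1) show ?thesis by (intro that[of "c / 2"]) simp_all
qed

lemma prob_cut_event_upper: "eventually (\<lambda>k. prob (cut_event k) \<le> 3 / cut_scale \<beta> k) sequentially"
proof -
  have "(\<lambda>k. relative_increment k * (1 + u (Suc k) / u k) * (cut_scale \<beta> (Suc k) / cut_scale \<beta> k))
      \<longlonglongrightarrow> 1 * (1 + 1) * 1"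
    by (intro tendsto_mult tendsto_add tendsto_const relative_increment_tendsto_1
        increment_ratio_tendsto_1 cut_scale_ratio_tendsto_1)
  hence "eventually (\<lambda>k. relative_increment k * (1 + u (Suc k) / u k) *
      (cut_scale \<beta> (Suc k) / cut_scale \<beta> k) < 3) sequentially"
    by (rule order_tendstoD) simp
  hence "eventually (\<lambda>k. prob (cut_event (Suc k)) \<le> 3 / cut_scale \<beta> (Suc k)) sequentially"
    using eventually_ge_at_top[of 5]
  proof eventually_elim
    case (elim k)
    have scale_pos: "cut_scale \<beta> k > 0" "cut_scale \<beta> (Suc k) > 0"
      using elim by (auto intro!: cut_scale_pos)
    have "h k * prob (cut_event (Suc k)) \<le> u k + u (Suc k)"
      using prob_cut_event_bounds(2)[of "Suc k"] elim by simp
    hence "prob (cut_event (Suc k)) \<le> (u k + u (Suc k)) / h k"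
      using h_pos[of k] by (simp add: field_simps)
    also have "\<dots> = relative_increment k * (1 + u (Suc k) / u k) / cut_scale \<beta> k"
      using scale_pos u_pos[of k] h_pos[of k] by (simp add: relative_increment_def field_simps)
    finally have "prob (cut_event (Suc k)) * cut_scale \<beta> (Suc k) \<le>
        relative_increment k * (1 + u (Suc k) / u k) / cut_scale \<beta> k * cut_scale \<beta> (Suc k)"
      using scale_pos by (intro mult_right_mono) auto
    also have "\<dots> \<le> 3" using elim by simp
    finally show ?case using scale_pos by (simp add: field_simps)
  qed
  thus ?thesis
    by (subst (asm) eventually_sequentially_Suc[of "\<lambda>k. prob (cut_event k) \<le> 3 / cut_scale \<beta> k"])
qed

end

locale critical_skip_walk = skip_walk q p1 p2 isX M Z + critical_walk q p1 p2 isX \<beta>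
  for q p1 p2 :: "nat \<Rightarrow> real" and isX :: bool and M :: "'a measure" and Z :: "nat \<Rightarrow> 'a \<Rightarrow> nat"
    and \<beta> :: real
begin

lemma prob_cut_event_order:
  obtains c where "c > 0"
    "eventually (\<lambda>k. c / cut_scale \<beta> k \<le> prob (cut_event k) \<and>
        prob (cut_event k) \<le> 3 / cut_scale \<beta> k) sequentially"
proof -
  obtain u where u_harmonic: "\<And>n. u n > 0" "harmonic_increments isX u"
    using obtain_harmonic_increments[of isX] by blast
  interpret critical_harmonic_walk q p1 p2 isX M Z u \<beta>
    using u_harmonic cut_scale_tail_sum_tendsto_1(1)[OF u_harmonic(1)
      increment_ratio_asymptotics[OF u_harmonic]] by unfold_locales
  show ?thesis
    using prob_cut_event_lower that eventually_conj[OF _ prob_cut_event_upper] by metis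
qed

end

context skip_walk
begin

lemma num_cutpoints_eq_sum:
  assumes "\<omega> \<in> space M"
  shows "real (num_cutpoints isX (\<lambda>i. Z i \<omega>) n) = (\<Sum>k=2..n. indicator (cut_event k) \<omega>)"
proof -
  have "(\<Sum>k=2..n. indicator (cut_event k) \<omega>) =
      (\<Sum>k=2..n. if is_cutpoint isX (\<lambda>i. Z i \<omega>) k then 1 else 0 :: real)"
    using assms by (intro sum.cong) (auto simp: cut_event_def indicator_def)
  thus ?thesis by (simp add: num_cutpoints_def flip: sum.inter_filter)
qed

lemma integrable_num_cutpoints: "integrable M (\<lambda>\<omega>. real (num_cutpoints isX (\<lambda>i. Z i \<omega>) n))"
  by (subst Bochner_Integration.integrable_cong[OF refl num_cutpoints_eq_sum])
    (auto intro!: Bochner_Integration.integrable_sum simp: emeasure_eq_measure)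

lemma expectation_num_cutpoints:
  "expectation (\<lambda>\<omega>. real (num_cutpoints isX (\<lambda>i. Z i \<omega>) n)) = (\<Sum>k=2..n. prob (cut_event k))"
  by (subst Bochner_Integration.integral_cong[OF refl num_cutpoints_eq_sum])
    (auto simp: Bochner_Integration.integral_sum emeasure_eq_measure)

end

lemma mono_num_cutpoints: "mono (\<lambda>n. real (num_cutpoints isX p n))"
  unfolding num_cutpoints_def by (intro monoI of_nat_mono card_mono) auto

lemma (in critical_skip_walk) expectation_num_cutpoints_order:
  obtains c C where "0 < c" "c < C"
    "eventually (\<lambda>n. c * count_scale \<beta> n \<le>
        expectation (\<lambda>\<omega>. real (num_cutpoints isX (\<lambda>i. Z i \<omega>) n)) \<and>
      expectation (\<lambda>\<omega>. real (num_cutpoints isX (\<lambda>i. Z i \<omega>) n)) \<le> C * count_scale \<beta> n) sequentially"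
proof -
  obtain c where "c > 0"
    "eventually (\<lambda>k. c / cut_scale \<beta> k \<le> prob (cut_event k) \<and>
        prob (cut_event k) \<le> 3 / cut_scale \<beta> k) sequentially"
    by (rule prob_cut_event_order)
  hence order: "eventually (\<lambda>n. c / 4 * count_scale \<beta> n \<le> (\<Sum>k=2..n. prob (cut_event k)) \<and>
      (\<Sum>k=2..n. prob (cut_event k)) \<le> 4 * 3 * count_scale \<beta> n) sequentially"
    by (intro sum_order_count_scale) auto
  show ?thesis
  proof (rule that)
    show "0 < c / 4" "c / 4 < c / 4 + 12" using \<open>c > 0\<close> by simp_all
    show "eventually (\<lambda>n. c / 4 * count_scale \<beta> n \<le>
        expectation (\<lambda>\<omega>. real (num_cutpoints isX (\<lambda>i. Z i \<omega>) n)) \<and>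
        expectation (\<lambda>\<omega>. real (num_cutpoints isX (\<lambda>i. Z i \<omega>) n)) \<le>
          (c / 4 + 12) * count_scale \<beta> n) sequentially"
      using order eventually_ge_at_top[of 4]
    proof eventually_elim
      case (elim n)
      have "0 \<le> c / 4 * count_scale \<beta> n" using count_scale_pos[of n \<beta>] elim \<open>c > 0\<close> by simp
      with elim show ?case unfolding expectation_num_cutpoints by (simp add: distrib_right)
    qed
  qed
qed

theorem theorem2:
  fixes q p1 p2 :: "nat \<Rightarrow> real" and isX :: bool
    and M :: "'a measure" and Z :: "nat \<Rightarrow> 'a \<Rightarrow> nat" and \<beta> :: real
  assumes probs: "\<And>k. k \<ge> 2 \<Longrightarrow> q k > 0 \<and> p1 k \<ge> 0 \<and> p2 k > 0 \<and> q k + p1 k + p2 k = 1"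
    and chain: "is_markov_chain M Z 2 (trans_kernel isX q p1 p2)"
    and a_lim: "\<exists>a>0. (\<lambda>k. (p1 k + p2 k) / q k) \<longlonglongrightarrow> a"
    and b_lim: "\<exists>b>0. (\<lambda>k. p2 k / q k) \<longlonglongrightarrow> b"
    and beta: "0 \<le> \<beta>" "\<beta> < 1"
    and rho: "(\<lambda>k. rho_walk q p1 p2 k - (if isX then 1 - 3 * r_seq \<beta> k else 1 + 3 * r_seq \<beta> k))
               \<in> O(\<lambda>k. (r_seq \<beta> k)\<^sup>2)"
  shows "(\<exists>c3 c4. 0 < c3 \<and> c3 < c4 \<and>
           ereal c3 \<le> liminf (\<lambda>n. ereal (prob_space.expectation M (\<lambda>\<omega>. real (num_cutpoints isX (\<lambda>i. Z i \<omega>) n))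
                          / (ln (real n) * (ln (ln (real n))) powr (- \<beta>)))) \<and>
           liminf (\<lambda>n. ereal (prob_space.expectation M (\<lambda>\<omega>. real (num_cutpoints isX (\<lambda>i. Z i \<omega>) n))
                          / (ln (real n) * (ln (ln (real n))) powr (- \<beta>))))
           \<le> limsup (\<lambda>n. ereal (prob_space.expectation M (\<lambda>\<omega>. real (num_cutpoints isX (\<lambda>i. Z i \<omega>) n))
                          / (ln (real n) * (ln (ln (real n))) powr (- \<beta>)))) \<and>
           limsup (\<lambda>n. ereal (prob_space.expectation M (\<lambda>\<omega>. real (num_cutpoints isX (\<lambda>i. Z i \<omega>) n))
                          / (ln (real n) * (ln (ln (real n))) powr (- \<beta>)))) \<le> ereal c4)
         \<and> (\<forall>\<epsilon>>0. AE \<omega> in M.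
              (\<lambda>n. real (num_cutpoints isX (\<lambda>i. Z i \<omega>) n)
                     / ((ln (real n)) powr (1 + \<epsilon>) * (ln (ln (real n))) powr (- \<beta>))) \<longlonglongrightarrow> 0)"
proof -
  interpret critical_skip_walk q p1 p2 isX M Z \<beta>
    by unfold_locales (fact probs chain a_lim b_lim rho)+
  let ?ES = "\<lambda>n. expectation (\<lambda>\<omega>. real (num_cutpoints isX (\<lambda>i. Z i \<omega>) n))"
  obtain c C where "0 < c" "c < C"
    and order: "eventually (\<lambda>n. c * count_scale \<beta> n \<le> ?ES n \<and>
        ?ES n \<le> C * count_scale \<beta> n) sequentially"
    by (rule expectation_num_cutpoints_order)
  have "eventually (\<lambda>n. ereal c \<le> ereal (?ES n / count_scale \<beta> n) \<and>
      ereal (?ES n / count_scale \<beta> n) \<le> ereal C) sequentially"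
    using order eventually_ge_at_top[of 4]
    by eventually_elim (simp add: count_scale_pos pos_le_divide_eq pos_divide_le_eq)
  note bounds = liminf_limsup_bounds[OF this, unfolded count_scale_def]
  have "AE \<omega> in M. (\<lambda>n. real (num_cutpoints isX (\<lambda>i. Z i \<omega>) n) / as_scale \<beta> \<epsilon> n) \<longlonglongrightarrow> 0"
    if "\<epsilon> > 0" for \<epsilon>
    using order
    by (intro AE_div_as_scale_tendsto_0[where K = C] beta that integrable_num_cutpoints
        mono_num_cutpoints)
      (auto elim: eventually_mono)
  with bounds \<open>0 < c\<close> \<open>c < C\<close> show ?thesis unfolding as_scale_def by blast
qed

end
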